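(* Assume $8\mathrm{e}p\Delta^3\le0.99p'$. Let $X=X^n$ be the random partial assignment generated by the process described in the context, and let $T_{\mathrm{Rej}}(X)$ be the cost of running the rejection sampling procedure (described in the context) on $\Phi$, $X$ and $S=V\setminus\Lambda(X)$. Then, with expectation taken over both $X$ and the randomness of the rejection sampling, the expected number of queries to the evaluation oracle is at most $10\Delta^5n$ and the expected computation cost is $O(qk\Delta^5n)$.
   Context: CSP formula $\Phi=(V,\mathcal{Q},\mathcal{C})$: finite variable set $V=\{v_1,\dots,v_n\}$ (with this fixed ordering); finite domains $Q_v$, $q_v=|Q_v|\ge2$; constraints $c\in\mathcal{C}$ with scope $\mathsf{vbl}(c)$ and $c:\bigotimes_{u\in\mathsf{vbl}(c)}Q_u\to\{\mathtt{True},\mathtt{False}\}$. $q=\max q_v$, $k=\max|\mathsf{vbl}(c)|$, $\Delta=\max_c|\{c':\mathsf{vbl}(c)\cap\mathsf{vbl}(c')\ne\emptyset\}|$ (counting $c$); $\mathbb{P}$ uniform product distribution; $p=\max_c\mathbb{P}[\neg c]$. Partial assignments $\sigma\in\bigotimes_v(Q_v\cup\{\star,\circ\})$ ($\star$ accessed unassigned, $\circ$ unaccessed); $\Lambda(\sigma)=\{v:\sigma(v)\in Q_v\}$, $\Lambda^+(\sigma)=\{v:\sigma(v)\ne\circ\}$; $\sigma_{u\gets x}$ replaces the value at $u$ by $x$; $\mathbb{P}[A\mid\sigma]$ conditions on agreement on $\Lambda(\sigma)$; $\sigma$ satisfies $c$ if all extensions do; $\mu_u^\sigma$ is the marginal at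 $u$ of the uniform distribution on satisfying assignments conditioned on agreeing with $\sigma$ on $\Lambda(\sigma)$. Let $p'=(18\mathrm{e}^2q^2k\Delta^4)^{-1}$. Fix a frozen-decision oracle which on $(c,\sigma)$ answers "yes" if $\mathbb{P}[\neg c\mid\sigma]>p'$, "no" if $<0.99p'$, otherwise arbitrarily but consistently (depending only on $c$ and $\sigma|_{\mathsf{vbl}(c)}$); $u$ is $\sigma$-fixed if $u\in\Lambda^+(\sigma)$ or $u\in\mathsf{vbl}(c)$ for some $c$ on which the oracle answers "yes". Process: $X^0=\circ^V$ and for $i=1,\dots,n$: if $v_i$ is $X^{i-1}$-fixed then $X^i=X^{i-1}$; otherwise $X^i=X^{i-1}_{v_i\gets b}$ with $b$ drawn from $\mu^{X^{i-1}}_{v_i}$. Rejection sampling on $(\Phi,\sigma,S)$: form the hypergraph $H^\sigma$ with vertex set $V\setminus\Lambda(\sigma)$ and, for each $c$ not satisfied by $\sigma$, a hyperedge $\mathsf{vbl}(c)\setminus\Lambda(\sigma)$; find its connected components intersecting $S$; for each such component independently, repeatedly draw a uniformly random assignment of its vertices until all its constraints (with $\sigma$ substituted) are satisfied, checking satisfaction via the evaluation oracle; return the resulting assignment restricted to $S$. The evaluation oracle answers, for $c$ and an assignment on a subset of $\mathsf{vbl}(c)$, whether $c$ is satisfied by all extensions. Input model: variables and constraints randomly accessible; $\mathsf{vbl}(c)$ retrievable in $O(k)$ time; constraints containing a variable, and constraints sharing a variable with a constraint, retrievable in $O(\Delta)$ time. *)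

theory Defs
  imports "HOL-Probability.Probability"
begin

section \<open>CSP formulas\<close>

record ('v, 'a, 'c) csp =
  vars :: "'v list"
  cons :: "'c list"
  vdom :: "'v \<Rightarrow> 'a set"
  vbl :: "'c \<Rightarrow> 'v set"
  pred :: "'c \<Rightarrow> ('v \<Rightarrow> 'a) \<Rightarrow> bool"

text \<open>
  Constraints are names of type \<open>'c\<close>, so that two of them may have the same scope and the same
  predicate. The lists \<open>vars\<close> and \<open>cons\<close> fix an ordering; \<open>vars\<close> is \<open>v\<^sub>1, \<dots>, v\<^sub>n\<close>.
  The predicate \<open>pred \<Phi> c\<close> is only ever applied to functions in \<open>\<Pi>\<^sub>E u\<in>vbl \<Phi> c. vdom \<Phi> u\<close>.

  The last conjunct of \<open>wf_csp\<close> says that \<open>k \<ge> 1\<close> (equivalently \<open>\<Delta> \<ge> 1\<close>); without it the maxima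
  are taken over the empty set, or the threshold \<open>p'\<close> is a division by zero.
\<close>

abbreviation vset :: "('v, 'a, 'c) csp \<Rightarrow> 'v set" where
  "vset \<Phi> \<equiv> set (vars \<Phi>)"

definition wf_csp :: "('v, 'a, 'c) csp \<Rightarrow> bool" where
  "wf_csp \<Phi> \<longleftrightarrow>
     distinct (vars \<Phi>) \<and> distinct (cons \<Phi>) \<and>
     (\<forall>v\<in>vset \<Phi>. finite (vdom \<Phi> v) \<and> 2 \<le> card (vdom \<Phi> v)) \<and>
     (\<forall>c\<in>set (cons \<Phi>). vbl \<Phi> c \<subseteq> vset \<Phi>) \<and>
     (\<exists>c\<in>set (cons \<Phi>). vbl \<Phi> c \<noteq> {})"

definition nvars :: "('v, 'a, 'c) csp \<Rightarrow> nat" where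
  "nvars \<Phi> = length (vars \<Phi>)"

definition max_dom :: "('v, 'a, 'c) csp \<Rightarrow> nat" where
  "max_dom \<Phi> = Max ((\<lambda>v. card (vdom \<Phi> v)) ` vset \<Phi>)"

definition width :: "('v, 'a, 'c) csp \<Rightarrow> nat" where
  "width \<Phi> = Max ((\<lambda>c. card (vbl \<Phi> c)) ` set (cons \<Phi>))"

definition max_deg :: "('v, 'a, 'c) csp \<Rightarrow> nat" where
  "max_deg \<Phi> =
     Max ((\<lambda>c. card {c' \<in> set (cons \<Phi>). vbl \<Phi> c \<inter> vbl \<Phi> c' \<noteq> {}}) ` set (cons \<Phi>))"

definition assignments :: "('v, 'a, 'c) csp \<Rightarrow> ('v \<Rightarrow> 'a) set" where
  "assignments \<Phi> = (\<Pi>\<^sub>E v\<in>vset \<Phi>. vdom \<Phi> v)"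

definition con_true :: "('v, 'a, 'c) csp \<Rightarrow> 'c \<Rightarrow> ('v \<Rightarrow> 'a) \<Rightarrow> bool" where
  "con_true \<Phi> c x \<longleftrightarrow> pred \<Phi> c (restrict x (vbl \<Phi> c))"

definition solutions :: "('v, 'a, 'c) csp \<Rightarrow> ('v \<Rightarrow> 'a) set" where
  "solutions \<Phi> = {x \<in> assignments \<Phi>. \<forall>c\<in>set (cons \<Phi>). con_true \<Phi> c x}"

definition uniform_on :: "('v, 'a, 'c) csp \<Rightarrow> 'v set \<Rightarrow> ('v \<Rightarrow> 'a) pmf" where
  "uniform_on \<Phi> U = Pi_pmf U undefined (\<lambda>v. pmf_of_set (vdom \<Phi> v))"

definition viol_prob :: "('v, 'a, 'c) csp \<Rightarrow> real" where
  "viol_prob \<Phi> =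
     Max ((\<lambda>c. measure_pmf.prob (uniform_on \<Phi> (vset \<Phi>)) {x. \<not> con_true \<Phi> c x}) ` set (cons \<Phi>))"


section \<open>Partial assignments and the random process\<close>

text \<open>\<open>Star\<close> is ``accessed but unassigned'', \<open>Circ\<close> is ``unaccessed''.\<close>

datatype 'a pval = Val 'a | Star | Circ

definition partial_assignments :: "('v, 'a, 'c) csp \<Rightarrow> ('v \<Rightarrow> 'a pval) set" where
  "partial_assignments \<Phi> =
     {\<sigma>. (\<forall>v\<in>vset \<Phi>. \<sigma> v \<in> Val ` vdom \<Phi> v \<union> {Star, Circ}) \<and> (\<forall>v. v \<notin> vset \<Phi> \<longrightarrow> \<sigma> v = Circ)}"

definition assigned :: "('v, 'a, 'c) csp \<Rightarrow> ('v \<Rightarrow> 'a pval) \<Rightarrow> 'v set" where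
  "assigned \<Phi> \<sigma> = {v \<in> vset \<Phi>. \<sigma> v \<in> Val ` vdom \<Phi> v}"

definition accessed :: "('v, 'a, 'c) csp \<Rightarrow> ('v \<Rightarrow> 'a pval) \<Rightarrow> 'v set" where
  "accessed \<Phi> \<sigma> = {v \<in> vset \<Phi>. \<sigma> v \<noteq> Circ}"

definition agrees :: "('v, 'a, 'c) csp \<Rightarrow> ('v \<Rightarrow> 'a pval) \<Rightarrow> ('v \<Rightarrow> 'a) set" where
  "agrees \<Phi> \<sigma> = {x. \<forall>v\<in>assigned \<Phi> \<sigma>. \<sigma> v = Val (x v)}"

definition satisfied_by :: "('v, 'a, 'c) csp \<Rightarrow> ('v \<Rightarrow> 'a pval) \<Rightarrow> 'c \<Rightarrow> bool" where
  "satisfied_by \<Phi> \<sigma> c \<longleftrightarrow> (\<forall>x\<in>assignments \<Phi> \<inter> agrees \<Phi> \<sigma>. con_true \<Phi> c x)"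

definition viol_prob_given :: "('v, 'a, 'c) csp \<Rightarrow> ('v \<Rightarrow> 'a pval) \<Rightarrow> 'c \<Rightarrow> real" where
  "viol_prob_given \<Phi> \<sigma> c =
     measure_pmf.prob (cond_pmf (uniform_on \<Phi> (vset \<Phi>)) (agrees \<Phi> \<sigma>)) {x. \<not> con_true \<Phi> c x}"

definition marginal :: "('v, 'a, 'c) csp \<Rightarrow> ('v \<Rightarrow> 'a pval) \<Rightarrow> 'v \<Rightarrow> 'a pmf" where
  "marginal \<Phi> \<sigma> u = map_pmf (\<lambda>x. x u) (cond_pmf (pmf_of_set (solutions \<Phi>)) (agrees \<Phi> \<sigma>))"

definition p_thr :: "('v, 'a, 'c) csp \<Rightarrow> real" where
  "p_thr \<Phi> = 1 / (18 * (exp 1)\<^sup>2 * real (max_dom \<Phi>) ^ 2 * real (width \<Phi>) * real (max_deg \<Phi>) ^ 4)"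

definition frozen_oracle :: "('v, 'a, 'c) csp \<Rightarrow> ('c \<Rightarrow> ('v \<Rightarrow> 'a pval) \<Rightarrow> bool) \<Rightarrow> bool" where
  "frozen_oracle \<Phi> D \<longleftrightarrow>
     (\<forall>c\<in>set (cons \<Phi>). \<forall>\<sigma>\<in>partial_assignments \<Phi>.
        (viol_prob_given \<Phi> \<sigma> c > p_thr \<Phi> \<longrightarrow> D c \<sigma>) \<and>
        (viol_prob_given \<Phi> \<sigma> c < 0.99 * p_thr \<Phi> \<longrightarrow> \<not> D c \<sigma>) \<and>
        (\<forall>\<tau>\<in>partial_assignments \<Phi>. (\<forall>v\<in>vbl \<Phi> c. \<sigma> v = \<tau> v) \<longrightarrow> D c \<sigma> = D c \<tau>))"

definition is_fixed ::
    "('v, 'a, 'c) csp \<Rightarrow> ('c \<Rightarrow> ('v \<Rightarrow> 'a pval) \<Rightarrow> bool) \<Rightarrow> ('v \<Rightarrow> 'a pval) \<Rightarrow> 'v \<Rightarrow> bool" where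
  "is_fixed \<Phi> D \<sigma> u \<longleftrightarrow> u \<in> accessed \<Phi> \<sigma> \<or> (\<exists>c\<in>set (cons \<Phi>). u \<in> vbl \<Phi> c \<and> D c \<sigma>)"

text \<open>\<open>process \<Phi> D i\<close> is the law of \<open>X\<^sup>i\<close>; with indices from 0, \<open>v\<^sub>i\<^sub>+\<^sub>1\<close> is \<open>vars \<Phi> ! i\<close>.\<close>

primrec process ::
    "('v, 'a, 'c) csp \<Rightarrow> ('c \<Rightarrow> ('v \<Rightarrow> 'a pval) \<Rightarrow> bool) \<Rightarrow> nat \<Rightarrow> ('v \<Rightarrow> 'a pval) pmf" where
  "process \<Phi> D 0 = return_pmf (\<lambda>_. Circ)"
| "process \<Phi> D (Suc i) =
     bind_pmf (process \<Phi> D i) (\<lambda>\<sigma>. let u = vars \<Phi> ! i in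
       if is_fixed \<Phi> D \<sigma> u then return_pmf \<sigma>
       else map_pmf (\<lambda>b. \<sigma>(u := Val b)) (marginal \<Phi> \<sigma> u))"


section \<open>Probabilistic programs with costs\<close>

text \<open>
  A program yields its result, the number of queries made to the evaluation oracle, and the
  computation cost; \<^const>\<open>None\<close> carries the probability of running forever.
\<close>

type_synonym 'r prog = "('r \<times> nat \<times> nat) spmf"

definition ret :: "'r \<Rightarrow> 'r prog" where
  "ret x = return_spmf (x, 0, 0)"

definition charge :: "nat \<Rightarrow> nat \<Rightarrow> unit prog" where
  "charge nq nt = return_spmf ((), nq, nt)"

definition draw :: "'r pmf \<Rightarrow> 'r prog" where
  "draw P = map_pmf (\<lambda>x. Some (x, 0, 0)) P"

definition seq :: "'r prog \<Rightarrow> ('r \<Rightarrow> 's prog) \<Rightarrow> 's prog" (infixr ";;" 60) where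
  "P ;; f = bind_spmf P (\<lambda>(x, nq, nt). map_spmf (\<lambda>(y, nq', nt'). (y, nq + nq', nt + nt')) (f x))"

lemma seq_mono [partial_function_mono]:
  assumes "mono_spmf P" and "\<And>x. mono_spmf (\<lambda>g. f x g)"
  shows "mono_spmf (\<lambda>g. P g ;; (\<lambda>x. f x g))"
  unfolding seq_def case_prod_beta
  by (intro bind_spmf_mono map_spmf_mono assms)

primrec foldp :: "('b \<Rightarrow> 's \<Rightarrow> 's prog) \<Rightarrow> 'b list \<Rightarrow> 's \<Rightarrow> 's prog" where
  "foldp f [] s = ret s"
| "foldp f (b # bs) s = f b s ;; (\<lambda>s'. foldp f bs s')"

text \<open>Expected costs; a run that does not terminate counts as infinitely expensive.\<close>

definition expected_queries :: "'r prog \<Rightarrow> ennreal" where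
  "expected_queries P =
     (\<integral>\<^sup>+ r. (case r of None \<Rightarrow> \<infinity> | Some (_, nq, nt) \<Rightarrow> of_nat nq) \<partial>measure_pmf P)"

definition expected_time :: "'r prog \<Rightarrow> ennreal" where
  "expected_time P =
     (\<integral>\<^sup>+ r. (case r of None \<Rightarrow> \<infinity> | Some (_, nq, nt) \<Rightarrow> of_nat nt) \<partial>measure_pmf P)"


section \<open>Rejection sampling\<close>

text \<open>
  The number \<open>a\<close> is the constant hidden in the input model. Retrieving \<open>vbl(c)\<close>, handling its at
  most \<open>k\<close> variables, or writing down a query to the evaluation oracle costs \<open>a * k\<close>; retrieving the
  constraints that contain a variable costs \<open>a * \<Delta>\<close>; drawing a uniform value for one variable costs
  \<open>a * q\<close>. The charges are the upper ends of the bounds. Marking a vertex or a constraint as found,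
  and testing whether it is marked, take constant time and are covered by these charges.

  The evaluation oracle sees the partial assignment only on \<open>vbl(c)\<close>.
\<close>

definition query :: "nat \<Rightarrow> ('v, 'a, 'c) csp \<Rightarrow> ('v \<Rightarrow> 'a pval) \<Rightarrow> 'c \<Rightarrow> bool prog" where
  "query a \<Phi> \<sigma> c =
     charge 1 (a * width \<Phi>) ;;
     (\<lambda>_. ret (satisfied_by \<Phi> (\<lambda>v. if v \<in> vbl \<Phi> c then \<sigma> v else Circ) c))"

text \<open>
  Graph search in \<open>H\<^sup>\<sigma>\<close>. A search state consists of the vertices still to be expanded, the
  vertices found so far (in particular those still to be expanded) and the constraints whose
  hyperedges have been found so far.
\<close>

definition hyperedge :: "('v, 'a, 'c) csp \<Rightarrow> ('v \<Rightarrow> 'a pval) \<Rightarrow> 'c \<Rightarrow> 'v list" where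
  "hyperedge \<Phi> \<sigma> c = filter (\<lambda>w. w \<in> vbl \<Phi> c - assigned \<Phi> \<sigma>) (vars \<Phi>)"

definition visit ::
    "nat \<Rightarrow> ('v, 'a, 'c) csp \<Rightarrow> ('v \<Rightarrow> 'a pval) \<Rightarrow> 'c \<Rightarrow>
     'v list \<times> 'v list \<times> 'c list \<Rightarrow> ('v list \<times> 'v list \<times> 'c list) prog" where
  "visit a \<Phi> \<sigma> c = (\<lambda>(todo, us, cs).
     query a \<Phi> \<sigma> c ;; (\<lambda>sat.
     if sat then ret (todo, us, cs)
     else
       charge 0 (a * width \<Phi>) ;; (\<lambda>_.
       let new = filter (\<lambda>w. w \<notin> set us) (hyperedge \<Phi> \<sigma> c)
       in ret (new @ todo, new @ us, List.insert c cs))))"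

partial_function (spmf) explore ::
    "nat \<Rightarrow> ('v, 'a, 'c) csp \<Rightarrow> ('v \<Rightarrow> 'a pval) \<Rightarrow>
     'v list \<times> 'v list \<times> 'c list \<Rightarrow> ('v list \<times> 'c list) prog" where
  "explore a \<Phi> \<sigma> st = (case st of (todo, us, cs) \<Rightarrow>
     (case todo of
        [] \<Rightarrow> ret (us, cs)
      | u # todo' \<Rightarrow>
          charge 0 (a * max_deg \<Phi>) ;; (\<lambda>_.
          foldp (visit a \<Phi> \<sigma>) (filter (\<lambda>c. u \<in> vbl \<Phi> c) (cons \<Phi>)) (todo', us, cs) ;; (\<lambda>st'.
          explore a \<Phi> \<sigma> st'))))"

definition find_components ::
    "nat \<Rightarrow> ('v, 'a, 'c) csp \<Rightarrow> ('v \<Rightarrow> 'a pval) \<Rightarrow> 'v set \<Rightarrow> ('v list \<times> 'c list) list prog" where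
  "find_components a \<Phi> \<sigma> S =
     foldp (\<lambda>v comps.
       charge 0 a ;; (\<lambda>_.
       if \<exists>(us, cs)\<in>set comps. v \<in> set us then ret comps
       else explore a \<Phi> \<sigma> ([v], [v], []) ;; (\<lambda>comp. ret (comp # comps))))
     (filter (\<lambda>v. v \<in> S) (vars \<Phi>)) []"

definition overlay :: "('v \<Rightarrow> 'a pval) \<Rightarrow> 'v set \<Rightarrow> ('v \<Rightarrow> 'a) \<Rightarrow> 'v \<Rightarrow> 'a pval" where
  "overlay \<sigma> U y = (\<lambda>v. if v \<in> U then Val (y v) else \<sigma> v)"

text \<open>One round queries every constraint of the component, even after one was found violated.\<close>

partial_function (spmf) sample_component ::
    "nat \<Rightarrow> ('v, 'a, 'c) csp \<Rightarrow> ('v \<Rightarrow> 'a pval) \<Rightarrow> 'v list \<Rightarrow> 'c list \<Rightarrow> ('v \<Rightarrow> 'a) prog" where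
  "sample_component a \<Phi> \<sigma> us cs =
     charge 0 (a * max_dom \<Phi> * length us) ;; (\<lambda>_.
     draw (uniform_on \<Phi> (set us)) ;; (\<lambda>y.
     foldp (\<lambda>c ok. query a \<Phi> (overlay \<sigma> (set us) y) c ;; (\<lambda>sat. ret (ok \<and> sat))) cs True ;; (\<lambda>ok.
     if ok then ret y else sample_component a \<Phi> \<sigma> us cs)))"

definition rejection_sampling ::
    "nat \<Rightarrow> ('v, 'a, 'c) csp \<Rightarrow> ('v \<Rightarrow> 'a pval) \<Rightarrow> 'v set \<Rightarrow> ('v \<Rightarrow> 'a) prog" where
  "rejection_sampling a \<Phi> \<sigma> S =
     find_components a \<Phi> \<sigma> S ;; (\<lambda>comps.
     foldp (\<lambda>(us, cs) x.
       sample_component a \<Phi> \<sigma> us cs ;; (\<lambda>y. ret (\<lambda>v. if v \<in> set us then y v else x v)))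
       comps (\<lambda>_. undefined) ;; (\<lambda>x.
     charge 0 (a * card S) ;; (\<lambda>_.
     ret (restrict x S))))"

definition rejection_after_process ::
    "nat \<Rightarrow> ('v, 'a, 'c) csp \<Rightarrow> ('c \<Rightarrow> ('v \<Rightarrow> 'a pval) \<Rightarrow> bool) \<Rightarrow> ('v \<Rightarrow> 'a) prog" where
  "rejection_after_process a \<Phi> D =
     bind_pmf (process \<Phi> D (nvars \<Phi>)) (\<lambda>X. rejection_sampling a \<Phi> X (vset \<Phi> - assigned \<Phi> X))"

end

theory Submission
  imports Defs
begin

text \<open>
  Put \<open>x = 2 q p'\<close>. Along the process every constraint keeps conditional violation probability at
  most \<open>q p'\<close>, since a non-frozen constraint has at most \<open>p'\<close> and one assignment multiplies this
  by at most \<open>q\<close>. The local lemma then bounds the marginals by \<open>(1 - \<Delta> x)\<inverse>\<close> times the uniform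
  ones, and the expected number of rounds on a component with \<open>N\<close> constraints by
  \<open>(1 - x)\<^bsup>-N\<^esup>\<close>.

  Every unassigned variable of the final partial assignment lies in a frozen constraint. A component
  with \<open>N\<close> constraints therefore contains at least \<open>N / \<Delta>\<^sup>2\<close> frozen constraints with pairwise
  disjoint scopes that are connected through steps of distance at most three. For a set \<open>T\<close> of
  constraints with disjoint scopes, the product of their conditional violation probabilities grows
  in expectation by at most a constant factor per constraint, so by Markov's inequality all of \<open>T\<close>
  is frozen with probability at most \<open>(16 \<Delta>\<^sup>3)\<^bsup>-|T|\<^esup>\<close>. This beats both the number of
  choices of \<open>T\<close>, of order \<open>(4 \<Delta>\<^sup>3)\<^bsup>|T|\<^esup>\<close>, and the cost \<open>\<Delta>\<^sup>2 4\<^bsup>|T|\<^esup>\<close>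
  of the component.
\<close>

section \<open>A local lemma\<close>

text \<open>Frozen constraints are not independent, since every marginal depends on the whole
  history. Working with violation probabilities instead of events avoids this: when scopes are
  disjoint, one step of the process touches at most one factor of the product, and only the ratio of
  the marginal to the uniform law is lost.

  The number 16 is 4 * 4. One factor 4 absorbs the cost \<open>4 ^ card T\<close>, of which 2 pays
  for the rounds and 2 for the number of constraints. The other is the price of summing over the
  choices of \<open>T\<close>. That sum is not obtained by counting trees: the clusters of a root in
  site percolation are disjoint events, so their probabilities add up to at most 1, and each of them
  is bounded below by a power of the right base. Each component is then charged to one of its own
  variables, which makes the final bound linear in the number of variables.\<close>

definition avoid :: "('c \<Rightarrow> 'b set) \<Rightarrow> 'c set \<Rightarrow> 'b set" where
  "avoid bad S = {w. \<forall>d\<in>S. w \<notin> bad d}"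

text \<open>A union bound inside the event \<open>avoid bad S2\<close>: each event of
  \<open>S1\<close> removes at most a fraction \<open>x\<close> of it.\<close>

lemma prob_avoid_union_ge:
  fixes M :: "'b pmf"
  assumes fin: "finite S1"
    and bad: "\<And>d. d \<in> S1 \<Longrightarrow>
      measure_pmf.prob M (bad d \<inter> avoid bad S2) \<le> x * measure_pmf.prob M (avoid bad S2)"
  shows "(1 - real (card S1) * x) * measure_pmf.prob M (avoid bad S2)
    \<le> measure_pmf.prob M (avoid bad (S1 \<union> S2))"
proof -
  let ?P = "measure_pmf.prob M"
  have "avoid bad S2 \<subseteq> avoid bad (S1 \<union> S2) \<union> (\<Union>d\<in>S1. bad d \<inter> avoid bad S2)"
    by (auto simp: avoid_def)
  then have "?P (avoid bad S2) \<le> ?P (avoid bad (S1 \<union> S2) \<union> (\<Union>d\<in>S1. bad d \<inter> avoid bad S2))"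
    by (intro measure_pmf.finite_measure_mono) auto
  also have "\<dots> \<le> ?P (avoid bad (S1 \<union> S2)) + ?P (\<Union>d\<in>S1. bad d \<inter> avoid bad S2)"
    by (rule measure_Un_le) auto
  also have "?P (\<Union>d\<in>S1. bad d \<inter> avoid bad S2) \<le> (\<Sum>d\<in>S1. ?P (bad d \<inter> avoid bad S2))"
    by (rule measure_UNION_le) (auto simp: fin)
  also have "\<dots> \<le> (\<Sum>d\<in>S1. x * ?P (avoid bad S2))"
    by (rule sum_mono) (use bad in auto)
  finally show ?thesis by (simp add: algebra_simps)
qed

text \<open>The symmetric Lovasz local lemma with one weight \<open>x\<close> for all events. The
  bounds \<open>x/2\<close> and \<open>1/2\<close> take the place of the usual product condition.
  Independence is stated as a product, so that no conditional probability given a possibly null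
  event has to be formed.\<close>

locale local_lemma =
  fixes M :: "'b pmf" and C :: "'c set" and bad :: "'c \<Rightarrow> 'b set"
    and nb :: "'c \<Rightarrow> 'c \<Rightarrow> bool" and x :: real
  assumes fin: "finite C"
    and indep: "\<And>c S. c \<in> C \<Longrightarrow> S \<subseteq> C \<Longrightarrow> (\<And>d. d \<in> S \<Longrightarrow> \<not> nb c d) \<Longrightarrow>
      measure_pmf.prob M (bad c \<inter> avoid bad S)
        = measure_pmf.prob M (bad c) * measure_pmf.prob M (avoid bad S)"
    and deg: "\<And>c. c \<in> C \<Longrightarrow> real (card {d \<in> C. nb c d}) * x \<le> 1/2"
    and small: "\<And>c. c \<in> C \<Longrightarrow> measure_pmf.prob M (bad c) \<le> x/2"
    and x: "0 \<le> x" "x < 1"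
begin

text \<open>Split \<open>S\<close> into the neighbours \<open>S1\<close> of \<open>c\<close> and the
  rest \<open>S2\<close>. Independence of \<open>S2\<close> gives the factor \<open>x/2\<close>; by
  induction, passing from \<open>S2\<close> back to \<open>S\<close> at most halves the probability,
  because the neighbours remove at most half of \<open>avoid bad S2\<close>.\<close>

lemma bad_le:
  assumes "S \<subseteq> C" "c \<in> C"
  shows "measure_pmf.prob M (bad c \<inter> avoid bad S) \<le> x * measure_pmf.prob M (avoid bad S)"
  using finite_subset[OF assms(1) fin] assms
proof (induction S arbitrary: c rule: finite_psubset_induct)
  case (psubset S)
  let ?P = "measure_pmf.prob M"
  define S1 where "S1 = {d \<in> S. nb c d}"
  define S2 where "S2 = {d \<in> S. \<not> nb c d}"
  have S: "S = S1 \<union> S2" "S1 \<subseteq> C" "S2 \<subseteq> C" "finite S1"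
    using psubset by (auto simp: S1_def S2_def)
  have half: "?P (avoid bad S2) \<le> 2 * ?P (avoid bad S)"
  proof (cases "S1 = {}")
    case True
    then show ?thesis using S by simp
  next
    case False
    then have "S2 \<subset> S" by (auto simp: S1_def S2_def)
    then have "(1 - real (card S1) * x) * ?P (avoid bad S2) \<le> ?P (avoid bad S)"
      unfolding S(1) using S
      by (intro prob_avoid_union_ge psubset.IH) auto
    moreover have "real (card S1) \<le> real (card {d \<in> C. nb c d})"
      unfolding S1_def using psubset.prems fin by (intro of_nat_mono card_mono) auto
    then have "real (card S1) * x \<le> 1/2"
      using deg[OF psubset.prems(2)] by (rule order_trans[OF mult_right_mono[OF _ x(1)]])
    then have "1/2 * ?P (avoid bad S2) \<le> (1 - real (card S1) * x) * ?P (avoid bad S2)"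
      by (intro mult_right_mono) auto
    ultimately show ?thesis by linarith
  qed
  have "?P (bad c \<inter> avoid bad S) \<le> ?P (bad c \<inter> avoid bad S2)"
    unfolding S(1) by (intro measure_pmf.finite_measure_mono) (auto simp: avoid_def)
  also have "\<dots> = ?P (bad c) * ?P (avoid bad S2)"
    using psubset.prems(2) S(3) by (rule indep) (simp add: S2_def)
  also have "\<dots> \<le> x/2 * (2 * ?P (avoid bad S))"
    by (intro mult_mono small psubset.prems half) (use x in auto)
  finally show ?case by simp
qed

text \<open>Chain rule: each further event to be avoided leaves a fraction of at least
  \<open>1 - x\<close>.\<close>

lemma avoid_ge: "S \<subseteq> C \<Longrightarrow> (1 - x) ^ card S \<le> measure_pmf.prob M (avoid bad S)"
proof -
  assume SC: "S \<subseteq> C"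
  have "finite S" using SC fin finite_subset by blast
  then show ?thesis using SC
  proof induction
    case empty
    show ?case by (simp add: avoid_def)
  next
    case (insert c S)
    have "(1 - x) ^ card (insert c S) = (1 - x) * (1 - x) ^ card S"
      using insert by simp
    also have "\<dots> \<le> (1 - x) * measure_pmf.prob M (avoid bad S)"
      using insert x by (intro mult_left_mono) auto
    also have "\<dots> \<le> measure_pmf.prob M (avoid bad (insert c S))"
      using prob_avoid_union_ge[of "{c}" M bad S x] bad_le insert by simp
    finally show ?case .
  qed
qed

lemma avoid_pos: "S \<subseteq> C \<Longrightarrow> 0 < measure_pmf.prob M (avoid bad S)"
  using avoid_ge[of S] x zero_less_power[of "1 - x" "card S"] by linarith

text \<open>Conditioning on avoiding everything raises the probability of \<open>B\<close> by a
  factor of at most 1 / (1 - m x), where \<open>N\<close> collects the events that may interact with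
  \<open>B\<close>. With the denominators cleared, the inequality stays meaningful, and trivial, for
  m x > 1.\<close>

lemma conditional_le:
  assumes ind: "measure_pmf.prob M (B \<inter> avoid bad (C - N))
        = measure_pmf.prob M B * measure_pmf.prob M (avoid bad (C - N))"
    and N: "N \<subseteq> C" "real (card N) \<le> m"
  shows "(1 - m * x) * measure_pmf.prob M (B \<inter> avoid bad C)
    \<le> measure_pmf.prob M B * measure_pmf.prob M (avoid bad C)"
proof (cases "m * x \<le> 1")
  case True
  let ?P = "measure_pmf.prob M"
  have finN: "finite N" using N fin finite_subset by blast
  have "?P (B \<inter> avoid bad C) \<le> ?P (B \<inter> avoid bad (C - N))"
    by (intro measure_pmf.finite_measure_mono) (auto simp: avoid_def)
  then have "(1 - m * x) * ?P (B \<inter> avoid bad C) \<le> (1 - m * x) * (?P B * ?P (avoid bad (C - N)))"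
    unfolding ind using True by (intro mult_left_mono) auto
  also have "\<dots> = ?P B * ((1 - m * x) * ?P (avoid bad (C - N)))" by simp
  also have "\<dots> \<le> ?P B * ((1 - real (card N) * x) * ?P (avoid bad (C - N)))"
    using N x by (intro mult_left_mono mult_right_mono) (auto intro: mult_right_mono)
  also have "\<dots> \<le> ?P B * ?P (avoid bad (N \<union> (C - N)))"
    by (intro mult_left_mono prob_avoid_union_ge bad_le finN) (use N in auto)
  also have "N \<union> (C - N) = C" using N by auto
  finally show ?thesis .
next
  case False
  then have "(1 - m * x) * measure_pmf.prob M (B \<inter> avoid bad C) \<le> 0"
    by (intro mult_nonpos_nonneg) auto
  also have "\<dots> \<le> measure_pmf.prob M B * measure_pmf.prob M (avoid bad C)" by simp
  finally show ?thesis .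
qed

end

section \<open>Weights of connected sets\<close>

text \<open>Encodes that every element of \<open>S\<close> is reached from \<open>A\<close> by
  \<open>adj\<close> steps inside \<open>S\<close>, as a cut condition: each proper intermediate set
  has a step leaving it within \<open>S\<close>. No paths have to be handled, and enlarging
  \<open>A\<close> inside \<open>S\<close> is immediate.\<close>

definition grown_from :: "('c \<Rightarrow> 'c \<Rightarrow> bool) \<Rightarrow> 'c set \<Rightarrow> 'c set \<Rightarrow> bool" where
  "grown_from adj A S \<longleftrightarrow> A \<subseteq> S \<and> (\<forall>B. A \<subseteq> B \<longrightarrow> B \<subset> S \<longrightarrow> (\<exists>b\<in>B. \<exists>w\<in>S - B. adj b w))"

lemma grown_from_refl: "grown_from adj A A"
  by (auto simp: grown_from_def)

lemma grown_from_insert_right: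
  assumes "grown_from adj A S" "t \<in> S" "adj t w"
  shows "grown_from adj A (insert w S)"
  unfolding grown_from_def
proof (intro conjI allI impI)
  show "A \<subseteq> insert w S" using assms by (auto simp: grown_from_def)
  fix B assume B: "A \<subseteq> B" "B \<subset> insert w S"
  show "\<exists>b\<in>B. \<exists>w'\<in>insert w S - B. adj b w'"
  proof (cases "S \<subseteq> B")
    case True
    then show ?thesis using B assms by blast
  next
    case False
    then have "A \<subseteq> B \<inter> S" "B \<inter> S \<subset> S" using B assms by (auto simp: grown_from_def)
    then obtain b w' where "b \<in> B \<inter> S" "w' \<in> S - B \<inter> S" "adj b w'"
      using assms(1)[unfolded grown_from_def, THEN conjunct2, rule_format, of "B \<inter> S"] by blast
    then show ?thesis by blast
  qed
qed

lemma grown_from_insert_left: "grown_from adj A S \<Longrightarrow> w \<in> S \<Longrightarrow> grown_from adj (insert w A) S"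
  by (auto simp: grown_from_def)

text \<open>The summand is the probability that the cluster of \<open>A\<close> in site percolation with parameter
  \<open>r\<close> is \<open>S\<close>, given that \<open>A\<close> is open and \<open>B\<close> is closed.\<close>

lemma cluster_weight_le_1:
  fixes r :: real
  assumes fin: "finite C" and r: "0 \<le> r" "r \<le> 1" and "A \<subseteq> C"
  shows "(\<Sum>S | S \<subseteq> C \<and> grown_from adj A S \<and> S \<inter> B = {}.
      r ^ card (S - A) * (1 - r) ^ card {w \<in> C - S - B. \<exists>s\<in>S. adj s w}) \<le> 1"
  using assms(4)
proof (induction "card (C - A - B)" arbitrary: A B rule: less_induct)
  case less
  let ?F = "\<lambda>A B. {S. S \<subseteq> C \<and> grown_from adj A S \<and> S \<inter> B = {}}"
  let ?g = "\<lambda>A B S. r ^ card (S - A) * (1 - r) ^ card {w \<in> C - S - B. \<exists>s\<in>S. adj s w}"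
  have finF: "finite (?F A B)" for A B
    by (rule finite_subset[of _ "Pow C"]) (auto simp: fin)
  show ?case
  proof (cases "\<exists>w\<in>C - A - B. \<exists>a\<in>A. adj a w")
    case True
    \<comment> \<open>Reveal the state of one undecided site \<open>w\<close> next to
      \<open>A\<close>. If open, it joins \<open>A\<close> at weight \<open>r\<close>; if closed, it
      joins \<open>B\<close> at weight \<open>1 - r\<close>. Either way fewer sites remain
      undecided.\<close>
    then obtain w a where w: "w \<in> C" "w \<notin> A" "w \<notin> B" "a \<in> A" "adj a w" by auto
    have split: "?F A B \<subseteq> ?F (insert w A) B \<union> ?F A (insert w B)"
    proof
      fix S assume "S \<in> ?F A B"
      then show "S \<in> ?F (insert w A) B \<union> ?F A (insert w B)"
        using grown_from_insert_left[of adj A S w] by (cases "w \<in> S") auto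
    qed
    have AS: "S \<in> ?F A B \<Longrightarrow> A \<subseteq> S" for S A B by (auto simp: grown_from_def)
    have disj: "?F (insert w A) B \<inter> ?F A (insert w B) = {}"
      by (auto simp: grown_from_def)
    have card_less: "card (C - insert w A - B) < card (C - A - B)"
      "card (C - A - insert w B) < card (C - A - B)"
      by (rule psubset_card_mono; use w fin in auto)+
    have "(\<Sum>S\<in>?F A B. ?g A B S)
        \<le> (\<Sum>S\<in>?F (insert w A) B \<union> ?F A (insert w B). ?g A B S)"
      using r by (intro sum_mono2 finite_UnI finF split) auto
    also have "\<dots> = (\<Sum>S\<in>?F (insert w A) B. ?g A B S) + (\<Sum>S\<in>?F A (insert w B). ?g A B S)"
      by (intro sum.union_disjoint finF disj)
    also have "(\<Sum>S\<in>?F (insert w A) B. ?g A B S) = (\<Sum>S\<in>?F (insert w A) B. r * ?g (insert w A) B S)"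
    proof (rule sum.cong[OF refl])
      fix S assume S: "S \<in> ?F (insert w A) B"
      then have "w \<in> S - A" "finite (S - A)"
        using w fin finite_subset by (auto simp: grown_from_def)
      from card.remove[OF this(2,1)] have "card (S - A) = Suc (card (S - insert w A))"
        by (simp add: Diff_insert[symmetric])
      then show "?g A B S = r * ?g (insert w A) B S" by simp
    qed
    also have "\<dots> = r * (\<Sum>S\<in>?F (insert w A) B. ?g (insert w A) B S)"
      by (simp add: sum_distrib_left)
    also have "\<dots> \<le> r * 1"
      by (intro mult_left_mono less.hyps card_less r) (use w less.prems in auto)
    also have "(\<Sum>S\<in>?F A (insert w B). ?g A B S)
        = (\<Sum>S\<in>?F A (insert w B). (1 - r) * ?g A (insert w B) S)"
    proof (rule sum.cong[OF refl])
      fix S assume S: "S \<in> ?F A (insert w B)"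
      have "{v \<in> C - S - B. \<exists>s\<in>S. adj s v}
          = insert w {v \<in> C - S - insert w B. \<exists>s\<in>S. adj s v}" (is "?L = _")
        using w S AS[OF S] by auto
      then have "card ?L = card (insert w {v \<in> C - S - insert w B. \<exists>s\<in>S. adj s v})"
        by (rule arg_cong)
      also have "\<dots> = Suc (card {v \<in> C - S - insert w B. \<exists>s\<in>S. adj s v})"
        by (rule card_insert_disjoint) (use fin in auto)
      finally have "card ?L = Suc (card {v \<in> C - S - insert w B. \<exists>s\<in>S. adj s v})" .
      then show "?g A B S = (1 - r) * ?g A (insert w B) S" by simp
    qed
    also have "\<dots> = (1 - r) * (\<Sum>S\<in>?F A (insert w B). ?g A (insert w B) S)"
      by (simp add: sum_distrib_left)
    also have "\<dots> \<le> (1 - r) * 1"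
      by (intro mult_left_mono less.hyps card_less) (use r less.prems in auto)
    finally show ?thesis by simp
  next
    case False
    have "?F A B \<subseteq> {A}"
    proof
      fix S assume S: "S \<in> ?F A B"
      then have "A \<subseteq> S" by (simp add: grown_from_def)
      moreover have False if "A \<subset> S"
      proof -
        have "\<exists>b\<in>A. \<exists>w\<in>S - A. adj b w"
          using S that unfolding grown_from_def mem_Collect_eq by (elim conjE allE[of _ A]) simp
        then obtain b w where w: "b \<in> A" "w \<in> S - A" "adj b w" by auto
        moreover have "w \<in> C - A - B" using S w(2) by auto
        ultimately show False using False by auto
      qed
      ultimately show "S \<in> {A}" by blast
    qed
    then have "(\<Sum>S\<in>?F A B. ?g A B S) \<le> (\<Sum>S\<in>{A}. ?g A B S)"
      using r by (intro sum_mono2) auto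
    also have "\<dots> \<le> 1" using r by (simp add: power_le_one)
    finally show ?thesis .
  qed
qed

text \<open>Percolation with r = 1 / (2 m): a set \<open>S\<close> has at most m |S| boundary sites,
  and (1 - r)^m \<ge> 1/2 by Bernoulli, so 1 / (4 m) \<le> r (1 - r)^m and the weight of
  \<open>S\<close> is dominated by its cluster probability. The root is open for free there, which
  leaves one spare factor \<open>r\<close> as the final bound.\<close>

lemma grown_weight_le:
  assumes fin: "finite C" and c: "c \<in> C" and m: "m \<ge> 1"
    and deg: "\<And>s. s \<in> C \<Longrightarrow> card {w \<in> C. adj s w} \<le> m"
  shows "(\<Sum>S | S \<subseteq> C \<and> grown_from adj {c} S. (1 / (4 * real m)) ^ card S) \<le> 1 / (2 * real m)"
proof -
  define r where "r = 1 / (2 * real m)"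
  have r: "0 \<le> r" "r \<le> 1" using m by (auto simp: r_def)
  let ?F = "{S. S \<subseteq> C \<and> grown_from adj {c} S}"
  have "(1 / (4 * real m)) ^ card S
      \<le> r * (r ^ card (S - {c}) * (1 - r) ^ card {w \<in> C - S. \<exists>s\<in>S. adj s w})"
    if S: "S \<in> ?F" for S
  proof -
    have finS: "finite S" and cS: "c \<in> S" using S fin finite_subset by (auto simp: grown_from_def)
    have "card {w \<in> C - S. \<exists>s\<in>S. adj s w} \<le> card (\<Union>s\<in>S. {w \<in> C. adj s w})"
      using fin finS by (intro card_mono) auto
    also have "\<dots> \<le> (\<Sum>s\<in>S. card {w \<in> C. adj s w})"
      by (rule card_UN_le[OF finS])
    also have "\<dots> \<le> card S * m"
      using sum_bounded_above[of S "\<lambda>s. card {w \<in> C. adj s w}" m] deg S by auto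
    finally have bd: "card {w \<in> C - S. \<exists>s\<in>S. adj s w} \<le> m * card S" by (simp add: mult.commute)
    have "1/2 \<le> (1 - r) ^ m"
      using Bernoulli_inequality[of "-r" m] r m by (simp add: r_def)
    then have "(1/(4 * real m)) \<le> r * (1 - r) ^ m"
      using mult_left_mono[OF _ r(1), of "1/2" "(1 - r) ^ m"] by (simp add: r_def field_simps)
    then have "(1/(4 * real m)) ^ card S \<le> (r * (1 - r) ^ m) ^ card S"
      by (intro power_mono) auto
    also have "\<dots> = r ^ card S * (1 - r) ^ (m * card S)"
      by (simp add: power_mult_distrib power_mult)
    also have "\<dots> \<le> r ^ card S * (1 - r) ^ card {w \<in> C - S. \<exists>s\<in>S. adj s w}"
      using r bd by (intro mult_left_mono power_decreasing) auto
    finally show ?thesis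
      using card.remove[OF finS cS] by (simp add: mult.assoc)
  qed
  then have "(\<Sum>S\<in>?F. (1 / (4 * real m)) ^ card S)
      \<le> (\<Sum>S\<in>?F. r * (r ^ card (S - {c}) * (1 - r) ^ card {w \<in> C - S. \<exists>s\<in>S. adj s w}))"
    by (rule sum_mono)
  also have "\<dots> = r * (\<Sum>S\<in>?F. r ^ card (S - {c}) * (1 - r) ^ card {w \<in> C - S. \<exists>s\<in>S. adj s w})"
    by (simp add: sum_distrib_left)
  also have "\<dots> \<le> r * 1"
    using cluster_weight_le_1[OF fin r, where A = "{c}" and B = "{}" and adj = adj] c r by (intro mult_left_mono) auto
  finally show ?thesis by (simp add: r_def)
qed

section \<open>Expected costs of programs\<close>

text \<open>An expected-cost transformer: \<open>f\<close> is the cost still to come, as a function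
  of the result. The weights \<alpha> and \<beta> let one computation serve both queries (1 and 0)
  and time (0 and 1).\<close>

definition wp :: "nat \<Rightarrow> nat \<Rightarrow> 'r prog \<Rightarrow> ('r \<Rightarrow> ennreal) \<Rightarrow> ennreal" where
  "wp \<alpha> \<beta> P f = (\<integral>\<^sup>+ r. (case r of None \<Rightarrow> \<infinity>
     | Some (x, nq, nt) \<Rightarrow> of_nat (\<alpha> * nq + \<beta> * nt) + f x) \<partial>measure_pmf P)"

lemma expected_queries_wp: "expected_queries P = wp 1 0 P (\<lambda>_. 0)"
  unfolding expected_queries_def wp_def
  by (intro nn_integral_cong) (auto split: option.split)

lemma expected_time_wp: "expected_time P = wp 0 1 P (\<lambda>_. 0)"
  unfolding expected_time_def wp_def
  by (intro nn_integral_cong) (auto split: option.split)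

lemma wp_return [simp]: "wp \<alpha> \<beta> (return_spmf (x, nq, nt)) f = of_nat (\<alpha> * nq + \<beta> * nt) + f x"
  by (simp add: wp_def)

lemma wp_ret [simp]: "wp \<alpha> \<beta> (ret x) f = f x"
  by (simp add: ret_def)

lemma wp_charge [simp]: "wp \<alpha> \<beta> (charge nq nt) f = of_nat (\<alpha> * nq + \<beta> * nt) + f ()"
  by (simp add: charge_def)

lemma wp_map_cost:
  "wp \<alpha> \<beta> (map_spmf (\<lambda>(y, nq', nt'). (y, nq + nq', nt + nt')) P) f
    = of_nat (\<alpha> * nq + \<beta> * nt) + wp \<alpha> \<beta> P f"
proof -
  have "wp \<alpha> \<beta> (map_spmf (\<lambda>(y, nq', nt'). (y, nq + nq', nt + nt')) P) f
      = (\<integral>\<^sup>+ r. of_nat (\<alpha> * nq + \<beta> * nt) + (case r of None \<Rightarrow> \<infinity>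
          | Some (x, nq, nt) \<Rightarrow> of_nat (\<alpha> * nq + \<beta> * nt) + f x) \<partial>measure_pmf P)"
    unfolding wp_def nn_integral_map_pmf
    by (intro nn_integral_cong) (auto split: option.split simp: algebra_simps)
  also have "\<dots> = of_nat (\<alpha> * nq + \<beta> * nt) + wp \<alpha> \<beta> P f"
    unfolding wp_def by (subst nn_integral_add) auto
  finally show ?thesis .
qed

lemma wp_seq [simp]: "wp \<alpha> \<beta> (P ;; g) f = wp \<alpha> \<beta> P (\<lambda>x. wp \<alpha> \<beta> (g x) f)"
proof -
  have "wp \<alpha> \<beta> (P ;; g) f = (\<integral>\<^sup>+ r. (case r of None \<Rightarrow> \<infinity> | Some (x, nq, nt) \<Rightarrow>
      wp \<alpha> \<beta> (map_spmf (\<lambda>(y, nq', nt'). (y, nq + nq', nt + nt')) (g x)) f) \<partial>measure_pmf P)"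
    unfolding seq_def bind_spmf_def
    by (subst wp_def, subst nn_integral_bind_pmf)
      (auto intro!: nn_integral_cong simp: wp_def split: option.split)
  also have "\<dots> = wp \<alpha> \<beta> P (\<lambda>x. wp \<alpha> \<beta> (g x) f)"
    unfolding wp_map_cost by (simp only: wp_def[of _ _ P])
  finally show ?thesis .
qed

lemma wp_mono: "(\<And>x. f x \<le> g x) \<Longrightarrow> wp \<alpha> \<beta> P f \<le> wp \<alpha> \<beta> P g"
  unfolding wp_def by (intro nn_integral_mono) (auto split: option.split intro: add_left_mono)

text \<open>The total mass is 1 once divergence is counted, and divergent runs contribute infinity
  on either side, so a constant can be taken out.\<close>

lemma wp_add_const: "wp \<alpha> \<beta> P (\<lambda>_. K) = wp \<alpha> \<beta> P (\<lambda>_. 0) + K"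
proof -
  have "wp \<alpha> \<beta> P (\<lambda>_. K) = (\<integral>\<^sup>+ r. (case r of None \<Rightarrow> \<infinity>
          | Some (x, nq, nt) \<Rightarrow> of_nat (\<alpha> * nq + \<beta> * nt) + (\<lambda>_. 0) x) + K \<partial>measure_pmf P)"
    unfolding wp_def by (intro nn_integral_cong) (auto split: option.split)
  then show ?thesis
    unfolding wp_def by (subst (asm) nn_integral_add) auto
qed

lemma wp_bind_pmf: "wp \<alpha> \<beta> (bind_pmf M g) f = (\<integral>\<^sup>+ x. wp \<alpha> \<beta> (g x) f \<partial>measure_pmf M)"
  by (simp add: wp_def)

lemma seq_return_spmf:
  "return_spmf (x, nq, nt) ;; g = map_spmf (\<lambda>(y, nq', nt'). (y, nq + nq', nt + nt')) (g x)"
  by (simp add: seq_def)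

lemma charge_seq_return: "g () = return_spmf (y, nq', nt') \<Longrightarrow>
    charge nq nt ;; g = return_spmf (y, nq + nq', nt + nt')"
  by (simp add: charge_def seq_return_spmf)

text \<open>A loop whose expected cost \<open>L\<close> satisfies \<open>L = K + (1 - p) L\<close> could still have \<open>L = \<infinity>\<close>.
  The truncated costs \<open>min m L\<close> are finite, obey the same recursion as an inequality, and
  converge to \<open>L\<close>.\<close>

lemma wp_loop_le:
  fixes U :: "'y pmf" and P :: "'r prog"
  assumes loop: "P = bind_pmf U (\<lambda>y. if good y then return_spmf (r y, nq, nt)
      else map_spmf (\<lambda>(y, nq', nt'). (y, nq + nq', nt + nt')) P)"
    and p: "0 < p" "p \<le> measure_pmf.prob U {y. good y}"
  shows "wp \<alpha> \<beta> P (\<lambda>_. 0) \<le> ennreal (real (\<alpha> * nq + \<beta> * nt) / p)"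
proof -
  define K where "K = \<alpha> * nq + \<beta> * nt"
  define cost :: "('r \<times> nat \<times> nat) option \<Rightarrow> ennreal" where
    "cost r = (case r of None \<Rightarrow> \<infinity> | Some (x, nq, nt) \<Rightarrow> of_nat (\<alpha> * nq + \<beta> * nt))" for r
  define L where "L m = (\<integral>\<^sup>+ r. min (of_nat m) (cost r) \<partial>measure_pmf P)" for m :: nat
  have bound: "L m \<le> ennreal (real K / p)" for m
  proof -
    have Lm: "L m \<le> of_nat m"
      using nn_integral_mono[of P "\<lambda>r. min (of_nat m) (cost r)" "\<lambda>_. of_nat m"]
      by (simp add: L_def)
    then obtain l where l: "L m = ennreal l" "0 \<le> l"
      by (metis ennreal_cases ennreal_of_nat_eq_real_of_nat ennreal_neq_top neq_top_trans)
    have shift: "(\<integral>\<^sup>+ r. min (of_nat m) (cost r) \<partial>measure_pmf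
        (map_spmf (\<lambda>(y, nq', nt'). (y, nq + nq', nt + nt')) P)) \<le> of_nat K + L m"
    proof -
      have cost_shift: "cost (map_option (\<lambda>(y, nq', nt'). (y, nq + nq', nt + nt')) r)
          = of_nat K + cost r" for r
        by (auto simp: cost_def K_def algebra_simps split: option.split)
      have "min (of_nat m) (of_nat K + cost r) \<le> of_nat K + min (of_nat m) (cost r)" for r
        by (auto simp: min_def intro: add_increasing)
      then have "(\<integral>\<^sup>+ r. min (of_nat m) (cost r) \<partial>measure_pmf
          (map_spmf (\<lambda>(y, nq', nt'). (y, nq + nq', nt + nt')) P))
          \<le> (\<integral>\<^sup>+ r. of_nat K + min (of_nat m) (cost r) \<partial>measure_pmf P)"
        unfolding nn_integral_map_pmf cost_shift by (intro nn_integral_mono) auto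
      also have "\<dots> = of_nat K + L m"
        unfolding L_def by (subst nn_integral_add) auto
      finally show ?thesis .
    qed
    have "L m = (\<integral>\<^sup>+ r. min (of_nat m) (cost r) \<partial>measure_pmf
        (bind_pmf U (\<lambda>y. if good y then return_spmf (r y, nq, nt)
          else map_spmf (\<lambda>(y, nq', nt'). (y, nq + nq', nt + nt')) P)))"
      unfolding L_def by (subst loop) (rule refl)
    also have "\<dots> \<le> (\<integral>\<^sup>+ y. of_nat K + L m * indicator {y. \<not> good y} y \<partial>measure_pmf U)"
      unfolding nn_integral_bind_pmf
    proof (intro nn_integral_mono)
      fix y
      show "(\<integral>\<^sup>+ r. min (of_nat m) (cost r) \<partial>measure_pmf (if good y then return_spmf (r y, nq, nt)
          else map_spmf (\<lambda>(y, nq', nt'). (y, nq + nq', nt + nt')) P))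
        \<le> of_nat K + L m * indicator {y. \<not> good y} y"
        using shift by (cases "good y") (auto simp: cost_def K_def min_def)
    qed
    also have "\<dots> = of_nat K + L m * emeasure (measure_pmf U) {y. \<not> good y}"
      by (subst nn_integral_add) (auto simp: nn_integral_cmult)
    also have "emeasure (measure_pmf U) {y. \<not> good y}
        = ennreal (1 - measure_pmf.prob U {y. good y})"
      using measure_pmf.prob_compl[of "{y. good y}" U]
      by (simp add: measure_pmf.emeasure_eq_measure Collect_neg_eq Compl_eq_Diff_UNIV)
    finally have "ennreal l \<le> ennreal (real K) + ennreal l * ennreal (1 - measure_pmf.prob U {y. good y})"
      by (simp add: l ennreal_of_nat_eq_real_of_nat)
    also have "\<dots> = ennreal (real K + l * (1 - measure_pmf.prob U {y. good y}))"
      using l by (simp add: ennreal_mult ennreal_plus)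
    finally have "l \<le> real K + l * (1 - measure_pmf.prob U {y. good y})"
      using l by (subst (asm) ennreal_le_iff) auto
    moreover have "l * p \<le> l * measure_pmf.prob U {y. good y}"
      using p l by (intro mult_left_mono) auto
    ultimately have "l * p \<le> real K" by (simp add: algebra_simps)
    then show ?thesis
      unfolding l using p l by (intro ennreal_leI) (simp add: field_simps)
  qed
  have SUP: "(SUP m. min (of_nat m) z) = (z::ennreal)" for z
  proof -
    have "(SUP m. min (of_nat m) z) = inf (SUP m. of_nat m) z"
      by (subst SUP_inf) (simp add: inf_min)
    then show ?thesis by (simp add: ennreal_SUP_of_nat_eq_top inf_min)
  qed
  have "wp \<alpha> \<beta> P (\<lambda>_. 0) = (\<integral>\<^sup>+ r. cost r \<partial>measure_pmf P)"
    unfolding wp_def cost_def by (intro nn_integral_cong) (auto split: option.split)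
  also have "\<dots> = (\<integral>\<^sup>+ r. (SUP m. min (of_nat m) (cost r)) \<partial>measure_pmf P)"
    by (simp add: SUP)
  also have "\<dots> = (SUP m. L m)"
    unfolding L_def
    by (rule nn_integral_monotone_convergence_SUP)
      (auto simp: incseq_def le_fun_def intro: min.coboundedI1)
  also have "\<dots> \<le> ennreal (real K / p)"
    by (rule SUP_least) (rule bound)
  finally show ?thesis by (simp add: K_def)
qed

section \<open>Uniform completions of partial assignments\<close>

lemma cond_pmf_of_set:
  assumes "finite A" "A \<inter> B \<noteq> {}"
  shows "cond_pmf (pmf_of_set A) B = pmf_of_set (A \<inter> B)"
proof (rule pmf_eqI)
  fix x
  have ne: "A \<noteq> {}" using assms by auto
  then have "set_pmf (pmf_of_set A) \<inter> B \<noteq> {}" using assms by simp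
  note ne = ne this
  have "card A \<noteq> 0" "card (A \<inter> B) \<noteq> 0" using assms by auto
  then show "pmf (cond_pmf (pmf_of_set A) B) x = pmf (pmf_of_set (A \<inter> B)) x"
    using assms ne by (auto simp: pmf_cond measure_pmf_of_set indicator_def)
qed

text \<open>The product law on \<open>V\<close> arises by gluing independent samples on
  \<open>A\<close> and \<open>V - A\<close>; under the gluing map the preimage of
  \<open>E \<inter> F\<close> is a rectangle.\<close>

lemma prob_Pi_pmf_split:
  assumes "finite V" "A \<subseteq> V"
    and E: "\<And>x y. (\<forall>v\<in>A. x v = y v) \<Longrightarrow> x \<in> E \<longleftrightarrow> y \<in> E"
    and F: "\<And>x y. (\<forall>v\<in>V - A. x v = y v) \<Longrightarrow> x \<in> F \<longleftrightarrow> y \<in> F"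
  shows "measure_pmf.prob (Pi_pmf V d p) (E \<inter> F)
    = measure_pmf.prob (Pi_pmf A d p) E * measure_pmf.prob (Pi_pmf (V - A) d p) F"
proof -
  let ?h = "\<lambda>(f, g) x. if x \<in> A then f x else g x"
  have "V = A \<union> (V - A)" using assms by auto
  then have "Pi_pmf V d p = Pi_pmf (A \<union> (V - A)) d p" by simp
  also have "\<dots> = map_pmf ?h (pair_pmf (Pi_pmf A d p) (Pi_pmf (V - A) d p))"
    using assms finite_subset by (intro Pi_pmf_union) auto
  finally have eq: "Pi_pmf V d p = map_pmf ?h (pair_pmf (Pi_pmf A d p) (Pi_pmf (V - A) d p))" .
  have "?h fg \<in> E \<longleftrightarrow> fst fg \<in> E" "?h fg \<in> F \<longleftrightarrow> snd fg \<in> F" for fg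
    by (rule E F; auto simp: case_prod_beta)+
  then have vim: "?h -` (E \<inter> F) = E \<times> F"
    by (auto simp: mem_Times_iff)
  have "emeasure (measure_pmf (Pi_pmf V d p)) (E \<inter> F)
      = emeasure (measure_pmf (pair_pmf (Pi_pmf A d p) (Pi_pmf (V - A) d p))) (E \<times> F)"
    unfolding eq by (simp only: emeasure_map_pmf vim)
  also have "\<dots> = (\<integral>\<^sup>+ z. indicator (E \<times> F) z
      \<partial>measure_pmf (pair_pmf (Pi_pmf A d p) (Pi_pmf (V - A) d p)))"
    by simp
  also have "\<dots> = (\<integral>\<^sup>+ z. indicator E (fst z) * indicator F (snd z)
      \<partial>measure_pmf (pair_pmf (Pi_pmf A d p) (Pi_pmf (V - A) d p)))"
    by (simp add: indicator_times)
  also have "\<dots> = emeasure (measure_pmf (Pi_pmf A d p)) E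
      * emeasure (measure_pmf (Pi_pmf (V - A) d p)) F"
    by (simp add: nn_integral_pair_pmf' nn_integral_cmult nn_integral_multc)
  finally show ?thesis
    by (simp add: measure_pmf.emeasure_eq_measure ennreal_mult[symmetric])
qed

lemma prob_Pi_pmf_marginal:
  assumes "finite V" "A \<subseteq> V"
    and "\<And>x y. (\<forall>v\<in>A. x v = y v) \<Longrightarrow> x \<in> E \<longleftrightarrow> y \<in> E"
  shows "measure_pmf.prob (Pi_pmf V d p) E = measure_pmf.prob (Pi_pmf A d p) E"
  using prob_Pi_pmf_split[OF assms, where F = UNIV and d = d and p = p] by simp

lemma prob_Pi_pmf_indep:
  assumes "finite V" "A \<subseteq> V"
    and E: "\<And>x y. (\<forall>v\<in>A. x v = y v) \<Longrightarrow> x \<in> E \<longleftrightarrow> y \<in> E"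
    and F: "\<And>x y. (\<forall>v\<in>V - A. x v = y v) \<Longrightarrow> x \<in> F \<longleftrightarrow> y \<in> F"
  shows "measure_pmf.prob (Pi_pmf V d p) (E \<inter> F)
    = measure_pmf.prob (Pi_pmf V d p) E * measure_pmf.prob (Pi_pmf V d p) F"
  using prob_Pi_pmf_split[OF assms, where d = d and p = p]
    prob_Pi_pmf_marginal[OF assms(1,2) E, where d = d and p = p]
    prob_Pi_pmf_marginal[OF assms(1) Diff_subset F, where d = d and p = p] by simp

lemma con_true_cong: "(\<forall>v\<in>vbl \<Phi> c. x v = y v) \<Longrightarrow> con_true \<Phi> c x = con_true \<Phi> c y"
  unfolding con_true_def by (metis restrict_ext)

locale csp_formula =
  fixes \<Phi> :: "('v, 'a, 'c) csp"
  assumes wf: "wf_csp \<Phi>"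
begin

definition dom_of :: "('v \<Rightarrow> 'a pval) \<Rightarrow> 'v \<Rightarrow> 'a set" where
  "dom_of X v = {b \<in> vdom \<Phi> v. v \<in> assigned \<Phi> X \<longrightarrow> X v = Val b}"

text \<open>Conditioning the uniform law on a partial assignment gives a product law again, with the
  domains of assigned variables shrunk to a point (\<open>cond_uniform_on\<close>). Independence of
  disjoint scopes therefore persists at every stage of the process.\<close>

definition completion :: "('v \<Rightarrow> 'a pval) \<Rightarrow> ('v \<Rightarrow> 'a) pmf" where
  "completion X = Pi_pmf (vset \<Phi>) undefined (\<lambda>v. pmf_of_set (dom_of X v))"

definition violated :: "'c \<Rightarrow> ('v \<Rightarrow> 'a) set" where
  "violated c = {x. \<not> con_true \<Phi> c x}"

definition share :: "'c \<Rightarrow> 'c \<Rightarrow> bool" where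
  "share c d \<longleftrightarrow> vbl \<Phi> c \<inter> vbl \<Phi> d \<noteq> {}"

definition lx :: real where
  "lx = 2 * real (max_dom \<Phi>) * p_thr \<Phi>"

lemma finite_vdom: "v \<in> vset \<Phi> \<Longrightarrow> finite (vdom \<Phi> v)"
  and card_vdom: "v \<in> vset \<Phi> \<Longrightarrow> 2 \<le> card (vdom \<Phi> v)"
  and vbl_subset: "c \<in> set (cons \<Phi>) \<Longrightarrow> vbl \<Phi> c \<subseteq> vset \<Phi>"
  and distinct_vars: "distinct (vars \<Phi>)"
  and distinct_cons: "distinct (cons \<Phi>)"
  using wf by (auto simp: wf_csp_def)

lemma vdom_nonempty: "v \<in> vset \<Phi> \<Longrightarrow> vdom \<Phi> v \<noteq> {}"
  using card_vdom by fastforce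

lemma dom_of_finite: "v \<in> vset \<Phi> \<Longrightarrow> finite (dom_of X v)"
  using finite_vdom by (auto simp: dom_of_def)

lemma dom_of_nonempty: "v \<in> vset \<Phi> \<Longrightarrow> dom_of X v \<noteq> {}"
  using vdom_nonempty[of v] by (cases "X v") (auto simp: dom_of_def assigned_def image_iff)

lemma dom_of_unassigned: "v \<notin> assigned \<Phi> X \<Longrightarrow> dom_of X v = vdom \<Phi> v"
  by (auto simp: dom_of_def)

lemma PiE_dom_of: "PiE (vset \<Phi>) (dom_of X) = assignments \<Phi> \<inter> agrees \<Phi> X"
  by (auto simp: assignments_def agrees_def PiE_iff dom_of_def assigned_def)

lemma PiE_dom_of_finite: "finite (PiE (vset \<Phi>) (dom_of X))"
  by (intro finite_PiE) (auto simp: dom_of_finite)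

lemma PiE_dom_of_nonempty: "PiE (vset \<Phi>) (dom_of X) \<noteq> {}"
  by (simp add: PiE_eq_empty_iff dom_of_nonempty)

lemma completion_pmf_of_set: "completion X = pmf_of_set (PiE (vset \<Phi>) (dom_of X))"
proof -
  have "PiE_dflt (vset \<Phi>) undefined (dom_of X) = PiE (vset \<Phi>) (dom_of X)"
    by (auto simp: PiE_dflt_def PiE_iff extensional_def)
  then show ?thesis
    unfolding completion_def
    by (subst Pi_pmf_of_set) (auto simp: dom_of_finite dom_of_nonempty)
qed

lemma set_completion: "set_pmf (completion X) = PiE (vset \<Phi>) (dom_of X)"
  by (simp add: completion_pmf_of_set PiE_dom_of_finite PiE_dom_of_nonempty)

lemma cond_uniform_on: "cond_pmf (uniform_on \<Phi> (vset \<Phi>)) (agrees \<Phi> X) = completion X"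
proof -
  have "uniform_on \<Phi> (vset \<Phi>) = completion (\<lambda>_. Circ)"
    unfolding uniform_on_def completion_def
    by (intro Pi_pmf_cong) (auto simp: dom_of_def assigned_def image_iff)
  also have "\<dots> = pmf_of_set (assignments \<Phi>)"
    by (simp add: completion_pmf_of_set PiE_dom_of) (simp add: agrees_def assigned_def image_iff)
  finally have "uniform_on \<Phi> (vset \<Phi>) = pmf_of_set (assignments \<Phi>)" .
  moreover have "finite (assignments \<Phi>)"
    by (auto simp: assignments_def finite_vdom intro!: finite_PiE)
  ultimately show ?thesis
    using PiE_dom_of_nonempty by (simp add: cond_pmf_of_set completion_pmf_of_set PiE_dom_of)
qed

lemma viol_prob_given_eq: "viol_prob_given \<Phi> X c = measure_pmf.prob (completion X) (violated c)"
  by (simp add: viol_prob_given_def cond_uniform_on violated_def)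

lemma violated_cong: "(\<forall>v\<in>vbl \<Phi> c. x v = y v) \<Longrightarrow> x \<in> violated c \<longleftrightarrow> y \<in> violated c"
  using con_true_cong[of \<Phi> c x y] by (simp add: violated_def)

lemma viol_prob_given_cong:
  assumes "c \<in> set (cons \<Phi>)" "\<forall>v\<in>vbl \<Phi> c. X v = Y v"
  shows "viol_prob_given \<Phi> X c = viol_prob_given \<Phi> Y c"
proof -
  have dom: "dom_of X v = dom_of Y v" if "v \<in> vbl \<Phi> c" for v
    using assms that by (auto simp: dom_of_def assigned_def)
  have "measure_pmf.prob (completion X) (violated c)
      = measure_pmf.prob (Pi_pmf (vbl \<Phi> c) undefined (\<lambda>v. pmf_of_set (dom_of X v))) (violated c)" for X
    unfolding completion_def
    by (rule prob_Pi_pmf_marginal[OF _ vbl_subset[OF assms(1)] violated_cong]) simp_all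
  moreover have "Pi_pmf (vbl \<Phi> c) undefined (\<lambda>v. pmf_of_set (dom_of X v))
      = Pi_pmf (vbl \<Phi> c) undefined (\<lambda>v. pmf_of_set (dom_of Y v))"
    by (rule Pi_pmf_cong) (auto simp: dom)
  ultimately show ?thesis by (simp add: viol_prob_given_eq)
qed

lemma satisfied_by_iff: "satisfied_by \<Phi> X c \<longleftrightarrow> viol_prob_given \<Phi> X c = 0"
  unfolding satisfied_by_def viol_prob_given_eq measure_pmf_zero_iff set_completion PiE_dom_of
  by (auto simp: violated_def)

text \<open>Hence a query, which sees only the scope of \<open>c\<close>, answers the question about
  the whole partial assignment.\<close>

lemma satisfied_by_restrict:
  assumes "c \<in> set (cons \<Phi>)"
  shows "satisfied_by \<Phi> (\<lambda>v. if v \<in> vbl \<Phi> c then X v else Circ) c = satisfied_by \<Phi> X c"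
  unfolding satisfied_by_iff using assms by (subst viol_prob_given_cong) auto

section \<open>Fixing one variable of a uniform completion\<close>

lemma prob_completion_component:
  assumes "u \<in> vset \<Phi>" "u \<notin> assigned \<Phi> X" "b \<in> vdom \<Phi> u"
  shows "measure_pmf.prob (completion X) {x. x u = b} = 1 / real (card (vdom \<Phi> u))"
proof -
  have "measure_pmf.prob (completion X) {x. x u = b} = pmf (map_pmf (\<lambda>x. x u) (completion X)) b"
    by (simp add: pmf_map vimage_def)
  also have "map_pmf (\<lambda>x. x u) (completion X) = pmf_of_set (vdom \<Phi> u)"
    using assms unfolding completion_def by (simp add: Pi_pmf_component dom_of_unassigned)
  finally show ?thesis
    using assms finite_vdom[of u] vdom_nonempty[of u] by (simp add: indicator_def)
qed

lemma dom_of_update: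
  assumes "u \<in> vset \<Phi>" "u \<notin> assigned \<Phi> X" "b \<in> vdom \<Phi> u"
  shows "PiE (vset \<Phi>) (dom_of (X(u := Val b))) = PiE (vset \<Phi>) (dom_of X) \<inter> {x. x u = b}"
proof -
  have "dom_of (X(u := Val b)) v = (if v = u then {b} else dom_of X v)" for v
    using assms by (auto simp: dom_of_def assigned_def)
  then show ?thesis
    using assms by (auto simp: PiE_iff dom_of_unassigned split: if_splits)
qed

text \<open>Assigning \<open>u\<close> means conditioning on an event of probability
  \<open>1 / card (vdom \<Phi> u)\<close>. This is why one assignment multiplies a violation
  probability by at most the domain size.\<close>

lemma prob_completion_update:
  assumes "u \<in> vset \<Phi>" "u \<notin> assigned \<Phi> X" "b \<in> vdom \<Phi> u"
  shows "measure_pmf.prob (completion (X(u := Val b))) E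
    = real (card (vdom \<Phi> u)) * measure_pmf.prob (completion X) (E \<inter> {x. x u = b})"
proof -
  let ?S = "PiE (vset \<Phi>) (dom_of X)"
  have "card ?S \<noteq> 0" using PiE_dom_of_finite PiE_dom_of_nonempty by simp
  moreover have "card (vdom \<Phi> u) \<noteq> 0" using card_vdom[OF assms(1)] by linarith
  moreover have "real (card (?S \<inter> {x. x u = b})) / real (card ?S) = 1 / real (card (vdom \<Phi> u))"
    using prob_completion_component[OF assms]
    by (simp add: completion_pmf_of_set measure_pmf_of_set PiE_dom_of_finite PiE_dom_of_nonempty)
  ultimately have "real (card ?S) = real (card (vdom \<Phi> u)) * real (card (?S \<inter> {x. x u = b}))"
    by (simp add: field_simps)
  moreover have "?S \<inter> {x. x u = b} \<noteq> {}"
    using PiE_dom_of_nonempty dom_of_update[OF assms] by metis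
  ultimately show ?thesis
    using \<open>card (vdom \<Phi> u) \<noteq> 0\<close>
    by (simp add: completion_pmf_of_set dom_of_update[OF assms] measure_pmf_of_set PiE_dom_of_finite
        PiE_dom_of_nonempty Int_ac)
qed

text \<open>Law of total probability over the value of \<open>u\<close>: under a uniform choice of
  that value, the probability of \<open>E\<close> is a martingale.\<close>

lemma sum_prob_completion_update:
  assumes "u \<in> vset \<Phi>" "u \<notin> assigned \<Phi> X"
  shows "(\<Sum>b\<in>vdom \<Phi> u. measure_pmf.prob (completion (X(u := Val b))) E)
    = real (card (vdom \<Phi> u)) * measure_pmf.prob (completion X) E"
proof -
  have "(\<Sum>b\<in>vdom \<Phi> u. measure_pmf.prob (completion X) (E \<inter> {x. x u = b}))
      = measure_pmf.prob (completion X) (\<Union>b\<in>vdom \<Phi> u. E \<inter> {x. x u = b})"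
    by (rule measure_pmf.finite_measure_finite_Union[symmetric])
      (auto simp: finite_vdom assms disjoint_family_on_def)
  also have "\<dots> = measure_pmf.prob (completion X) E"
    by (rule measure_pmf.finite_measure_eq_AE)
      (use assms in \<open>auto simp: AE_measure_pmf_iff set_completion PiE_iff dom_of_def\<close>)
  finally show ?thesis
    using assms by (simp add: prob_completion_update sum_distrib_left[symmetric])
qed

section \<open>Estimates for the parameters of the formula\<close>

lemma card_share_le: "c \<in> set (cons \<Phi>) \<Longrightarrow> card {d \<in> set (cons \<Phi>). share c d} \<le> max_deg \<Phi>"
  unfolding max_deg_def share_def by (intro Max_ge) auto

lemma card_vbl_le: "c \<in> set (cons \<Phi>) \<Longrightarrow> card (vbl \<Phi> c) \<le> width \<Phi>"
  unfolding width_def by (intro Max_ge) auto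

lemma card_vdom_le: "v \<in> vset \<Phi> \<Longrightarrow> card (vdom \<Phi> v) \<le> max_dom \<Phi>"
  unfolding max_dom_def by (intro Max_ge) auto

lemma finite_vbl: "c \<in> set (cons \<Phi>) \<Longrightarrow> finite (vbl \<Phi> c)"
  using vbl_subset finite_subset by blast

lemma card_containing_le: "card {c \<in> set (cons \<Phi>). u \<in> vbl \<Phi> c} \<le> max_deg \<Phi>"
proof (cases "\<exists>c\<in>set (cons \<Phi>). u \<in> vbl \<Phi> c")
  case True
  then obtain c where c: "c \<in> set (cons \<Phi>)" "u \<in> vbl \<Phi> c" by auto
  then have "card {c \<in> set (cons \<Phi>). u \<in> vbl \<Phi> c} \<le> card {d \<in> set (cons \<Phi>). share c d}"
    by (intro card_mono) (auto simp: share_def)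
  then show ?thesis using card_share_le[OF c(1)] by linarith
next
  case False
  then have "{c \<in> set (cons \<Phi>). u \<in> vbl \<Phi> c} = {}" by auto
  then show ?thesis by (simp only: card.empty)
qed

lemma params_ge: "1 \<le> max_deg \<Phi>" "1 \<le> width \<Phi>" "2 \<le> max_dom \<Phi>"
proof -
  obtain c where c: "c \<in> set (cons \<Phi>)" "vbl \<Phi> c \<noteq> {}" using wf by (auto simp: wf_csp_def)
  then have "c \<in> {d \<in> set (cons \<Phi>). share c d}" by (auto simp: share_def)
  then have "card {d \<in> set (cons \<Phi>). share c d} \<noteq> 0" by auto
  then show "1 \<le> max_deg \<Phi>" using card_share_le[OF c(1)] by linarith
  have "card (vbl \<Phi> c) \<noteq> 0" using c finite_vbl by auto
  then show "1 \<le> width \<Phi>" using card_vbl_le[OF c(1)] by linarith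
  obtain v where "v \<in> vset \<Phi>" using c vbl_subset by blast
  then show "2 \<le> max_dom \<Phi>" using card_vdom card_vdom_le le_trans by blast
qed

lemma p_thr_pos: "0 < p_thr \<Phi>"
  unfolding p_thr_def using params_ge by (intro divide_pos_pos mult_pos_pos) auto

lemma lx_pos: "0 < lx"
  using p_thr_pos params_ge by (simp add: lx_def)

text \<open>Inserting the threshold, the left side is 1 / (9 e^2 q \<Delta>^2), and q \<ge> 2
  already gives 1/18.\<close>

lemma lx_small: "real (width \<Phi>) * real (max_deg \<Phi>) ^ 2 * lx \<le> 1/18"
proof -
  define d k q where dkq: "d = real (max_deg \<Phi>)" "k = real (width \<Phi>)" "q = real (max_dom \<Phi>)"
  have ge: "1 \<le> d" "1 \<le> k" "2 \<le> q" using params_ge by (auto simp: dkq)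
  have e: "2 \<le> exp (1::real)" using exp_ge_add_one_self[of 1] by simp
  have "k * d ^ 2 * lx = 1 / (9 * (exp 1)\<^sup>2 * q * d ^ 2)"
    unfolding lx_def p_thr_def dkq[symmetric] using ge
    by (simp add: field_simps power2_eq_square power4_eq_xxxx)
  also have "\<dots> \<le> 1 / (9 * 1 * 2 * 1)"
    using ge e by (intro divide_left_mono mult_mono) (auto intro: power_mono one_le_power)
  finally show ?thesis by (simp add: dkq)
qed

text \<open>The forms in which the smallness of \<open>lx\<close> is spent: the factor \<Delta> in
  the local lemma and the marginals, \<Delta>^2 for the rounds of a component, k \<Delta> for the
  growth over a whole scope, and the bare bound to keep \<open>1 - lx\<close> positive.\<close>

lemma mult_lx_le: "real (max_deg \<Phi>) * lx \<le> 1/18" "real (max_deg \<Phi>) ^ 2 * lx \<le> 1/18"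
  "real (width \<Phi>) * (real (max_deg \<Phi>) * lx) \<le> 1/18" "lx \<le> 1/18"
proof -
  define d k where dk: "d = real (max_deg \<Phi>)" "k = real (width \<Phi>)"
  have ge: "1 \<le> d" "1 \<le> k" using params_ge by (auto simp: dk)
  have le: "z * lx \<le> 1/18" if "z \<le> k * d ^ 2" for z
    using mult_right_mono[OF that, of lx] lx_pos lx_small unfolding dk by linarith
  have dd: "1 \<le> d ^ 2" "d \<le> d ^ 2"
    using ge by (auto simp: power2_eq_square intro: mult_ge1_I)
  have kd: "d ^ 2 \<le> k * d ^ 2" "k * d \<le> k * d ^ 2"
    using mult_right_mono[OF ge(2), of "d ^ 2"] mult_left_mono[OF dd(2), of k] ge by auto
  have "d * lx \<le> 1/18" "d ^ 2 * lx \<le> 1/18" "(k * d) * lx \<le> 1/18" "1 * lx \<le> 1/18"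
    by (rule le; use dd kd in linarith)+
  then show "real (max_deg \<Phi>) * lx \<le> 1/18" "real (max_deg \<Phi>) ^ 2 * lx \<le> 1/18"
    "real (width \<Phi>) * (real (max_deg \<Phi>) * lx) \<le> 1/18" "lx \<le> 1/18"
    unfolding dk by (simp_all add: mult.assoc)
qed

section \<open>The local lemma for completions, and marginals of satisfying assignments\<close>

lemma local_lemma_completion:
  assumes small: "\<And>c. c \<in> set (cons \<Phi>) \<Longrightarrow> viol_prob_given \<Phi> X c \<le> lx / 2"
  shows "local_lemma (completion X) (set (cons \<Phi>)) violated share lx"
proof
  fix c S
  assume c: "c \<in> set (cons \<Phi>)" and S: "S \<subseteq> set (cons \<Phi>)" and disj: "\<And>d. d \<in> S \<Longrightarrow> \<not> share c d"
  show "measure_pmf.prob (completion X) (violated c \<inter> avoid violated S)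
      = measure_pmf.prob (completion X) (violated c) * measure_pmf.prob (completion X) (avoid violated S)"
    unfolding completion_def
  proof (rule prob_Pi_pmf_indep)
    show "vbl \<Phi> c \<subseteq> vset \<Phi>" by (rule vbl_subset[OF c])
    fix x y :: "'v \<Rightarrow> 'a"
    show "\<forall>v\<in>vbl \<Phi> c. x v = y v \<Longrightarrow> (x \<in> violated c) = (y \<in> violated c)"
      by (rule violated_cong)
    assume agree: "\<forall>v\<in>vset \<Phi> - vbl \<Phi> c. x v = y v"
    have "x \<in> violated d \<longleftrightarrow> y \<in> violated d" if "d \<in> S" for d
      by (rule violated_cong) (use agree disj[OF that] S that vbl_subset[of d] in \<open>auto simp: share_def\<close>)
    then show "x \<in> avoid violated S \<longleftrightarrow> y \<in> avoid violated S"
      by (auto simp: avoid_def)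
  qed simp
next
  fix c assume c: "c \<in> set (cons \<Phi>)"
  have "real (card {d \<in> set (cons \<Phi>). share c d}) * lx \<le> real (max_deg \<Phi>) * lx"
    using card_share_le[OF c] lx_pos by (intro mult_right_mono) auto
  then show "real (card {d \<in> set (cons \<Phi>). share c d}) * lx \<le> 1/2"
    using mult_lx_le(1) by linarith
  show "measure_pmf.prob (completion X) (violated c) \<le> lx / 2"
    using small[OF c] by (simp add: viol_prob_given_eq)
qed (use lx_pos mult_lx_le(4) in auto)

lemma solutions_agrees:
  "solutions \<Phi> \<inter> agrees \<Phi> X = PiE (vset \<Phi>) (dom_of X) \<inter> avoid violated (set (cons \<Phi>))"
  unfolding PiE_dom_of by (auto simp: solutions_def avoid_def violated_def)

context
  fixes X :: "'v \<Rightarrow> 'a pval" and u :: 'v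
  assumes small: "\<And>c. c \<in> set (cons \<Phi>) \<Longrightarrow> viol_prob_given \<Phi> X c \<le> lx / 2"
    and u: "u \<in> vset \<Phi>" "u \<notin> assigned \<Phi> X"
begin

interpretation local_lemma "completion X" "set (cons \<Phi>)" violated share lx
  by (rule local_lemma_completion[OF small])

text \<open>The positive avoidance probability provides a solution that agrees with
  \<open>X\<close>. Only then do \<open>pmf_of_set\<close> and \<open>cond_pmf\<close> in the
  definition of \<open>marginal\<close> have their intended values.\<close>

lemma marginal_eq: "marginal \<Phi> X u
  = map_pmf (\<lambda>x. x u) (pmf_of_set (PiE (vset \<Phi>) (dom_of X) \<inter> avoid violated (set (cons \<Phi>))))"
  and good_nonempty: "PiE (vset \<Phi>) (dom_of X) \<inter> avoid violated (set (cons \<Phi>)) \<noteq> {}"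
proof -
  show ne: "PiE (vset \<Phi>) (dom_of X) \<inter> avoid violated (set (cons \<Phi>)) \<noteq> {}"
    using avoid_pos[of "set (cons \<Phi>)"]
    by (auto simp: measure_pmf_zero_iff set_completion less_le)
  have "finite (solutions \<Phi>)"
    by (rule finite_subset[of _ "assignments \<Phi>"])
      (auto simp: solutions_def assignments_def finite_vdom intro!: finite_PiE)
  then show "marginal \<Phi> X u
    = map_pmf (\<lambda>x. x u) (pmf_of_set (PiE (vset \<Phi>) (dom_of X) \<inter> avoid violated (set (cons \<Phi>))))"
    using ne unfolding marginal_def by (subst cond_pmf_of_set) (auto simp: solutions_agrees)
qed

lemma set_marginal: "set_pmf (marginal \<Phi> X u) \<subseteq> vdom \<Phi> u"
  using good_nonempty u
  by (auto simp: marginal_eq PiE_dom_of_finite PiE_iff dom_of_def)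

text \<open>An instance of \<open>conditional_le\<close>: the event that \<open>u\<close> takes the
  value \<open>b\<close> interacts only with the constraints containing \<open>u\<close>, of which
  there are at most \<open>max_deg \<Phi>\<close>.\<close>

lemma marginal_le:
  assumes b: "b \<in> vdom \<Phi> u"
  shows "(1 - real (max_deg \<Phi>) * lx) * pmf (marginal \<Phi> X u) b \<le> 1 / real (card (vdom \<Phi> u))"
proof -
  let ?S = "PiE (vset \<Phi>) (dom_of X)"
  let ?G = "avoid violated (set (cons \<Phi>))"
  let ?P = "measure_pmf.prob (completion X)"
  let ?N = "{c \<in> set (cons \<Phi>). u \<in> vbl \<Phi> c}"
  have pos: "0 < ?P ?G" by (rule avoid_pos) simp
  have cardS: "card ?S \<noteq> 0" using PiE_dom_of_finite PiE_dom_of_nonempty by simp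
  have "pmf (marginal \<Phi> X u) b = real (card (?S \<inter> ?G \<inter> {x. x u = b})) / real (card (?S \<inter> ?G))"
    using good_nonempty
    by (simp add: marginal_eq pmf_map measure_pmf_of_set PiE_dom_of_finite vimage_def)
  also have "\<dots> = ?P ({x. x u = b} \<inter> ?G) / ?P ?G"
    using cardS by (simp add: completion_pmf_of_set measure_pmf_of_set PiE_dom_of_finite
        PiE_dom_of_nonempty Int_ac)
  finally have eq: "pmf (marginal \<Phi> X u) b = ?P ({x. x u = b} \<inter> ?G) / ?P ?G" .
  have "(1 - real (max_deg \<Phi>) * lx) * ?P ({x. x u = b} \<inter> ?G) \<le> ?P {x. x u = b} * ?P ?G"
  proof (rule conditional_le)
    show "?P ({x. x u = b} \<inter> avoid violated (set (cons \<Phi>) - ?N))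
        = ?P {x. x u = b} * ?P (avoid violated (set (cons \<Phi>) - ?N))"
      unfolding completion_def
    proof (rule prob_Pi_pmf_indep[where A = "{u}"])
      fix x y :: "'v \<Rightarrow> 'a" assume agree: "\<forall>v\<in>vset \<Phi> - {u}. x v = y v"
      have "x \<in> violated d \<longleftrightarrow> y \<in> violated d" if "d \<in> set (cons \<Phi>) - ?N" for d
        by (rule violated_cong) (use agree that vbl_subset[of d] in auto)
      then show "x \<in> avoid violated (set (cons \<Phi>) - ?N) \<longleftrightarrow> y \<in> avoid violated (set (cons \<Phi>) - ?N)"
        by (auto simp: avoid_def)
    qed (use u in auto)
  qed (use card_containing_le in auto)
  then show ?thesis
    using pos u b by (simp add: eq prob_completion_component field_simps)
qed

lemma nn_integral_marginal_le:
  assumes g: "\<And>b. b \<in> vdom \<Phi> u \<Longrightarrow> 0 \<le> g b"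
  shows "(\<integral>\<^sup>+ b. ennreal (g b) \<partial>measure_pmf (marginal \<Phi> X u))
    \<le> ennreal ((\<Sum>b\<in>vdom \<Phi> u. g b) / real (card (vdom \<Phi> u)) / (1 - real (max_deg \<Phi>) * lx))"
proof -
  have pos: "0 < 1 - real (max_deg \<Phi>) * lx" using mult_lx_le(1) by linarith
  have "(\<integral>\<^sup>+ b. ennreal (g b) \<partial>measure_pmf (marginal \<Phi> X u))
      = (\<Sum>b\<in>vdom \<Phi> u. ennreal (g b) * ennreal (pmf (marginal \<Phi> X u) b))"
    by (rule nn_integral_measure_pmf_support) (use u set_marginal finite_vdom in auto)
  also have "\<dots> = ennreal (\<Sum>b\<in>vdom \<Phi> u. g b * pmf (marginal \<Phi> X u) b)"
    using g by (subst sum_ennreal[symmetric]) (auto simp: ennreal_mult)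
  also have "\<dots> \<le> ennreal (\<Sum>b\<in>vdom \<Phi> u. g b * (1 / real (card (vdom \<Phi> u)) / (1 - real (max_deg \<Phi>) * lx)))"
  proof (intro ennreal_leI sum_mono mult_left_mono g)
    fix b assume "b \<in> vdom \<Phi> u"
    then show "pmf (marginal \<Phi> X u) b \<le> 1 / real (card (vdom \<Phi> u)) / (1 - real (max_deg \<Phi>) * lx)"
      using marginal_le[of b] by (subst pos_le_divide_eq[OF pos], subst mult.commute)
  qed
  finally show ?thesis by (simp add: sum_distrib_right sum_divide_distrib)
qed

end

end

section \<open>Frozen constraints\<close>

locale frozen_process = csp_formula \<Phi> for \<Phi> :: "('v, 'a, 'c) csp" +
  fixes D :: "'c \<Rightarrow> ('v \<Rightarrow> 'a pval) \<Rightarrow> bool"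
  assumes D_oracle: "frozen_oracle \<Phi> D"
    and lll: "8 * exp 1 * viol_prob \<Phi> * real (max_deg \<Phi>) ^ 3 \<le> 0.99 * p_thr \<Phi>"
begin

lemma viol_prob_given_Circ_le:
  assumes "c \<in> set (cons \<Phi>)"
  shows "viol_prob_given \<Phi> (\<lambda>_. Circ) c \<le> viol_prob \<Phi>"
proof -
  have "completion (\<lambda>_. Circ) = uniform_on \<Phi> (vset \<Phi>)"
    unfolding uniform_on_def completion_def
    by (intro Pi_pmf_cong) (auto simp: dom_of_def assigned_def image_iff)
  then show ?thesis
    unfolding viol_prob_given_eq viol_prob_def violated_def
    using assms by (intro Max_ge) auto
qed

lemma viol_prob_given_nonneg: "0 \<le> viol_prob_given \<Phi> X c"
  by (simp add: viol_prob_given_eq)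

lemma viol_prob_nonneg: "0 \<le> viol_prob \<Phi>"
proof -
  obtain c where "c \<in> set (cons \<Phi>)" using wf by (auto simp: wf_csp_def)
  then show ?thesis
    using viol_prob_given_Circ_le viol_prob_given_nonneg order_trans by blast
qed

text \<open>The constant 20 comes from e \<ge> 5/2, which gives 8 e \<ge> 20.\<close>

lemma viol_prob_le: "viol_prob \<Phi> \<le> p_thr \<Phi> / (20 * real (max_deg \<Phi>) ^ 3)"
proof -
  let ?d = "real (max_deg \<Phi>) ^ 3"
  have d: "0 < ?d" using params_ge by simp
  have "5/2 \<le> exp (1::real)"
    using exp_lower_Taylor_quadratic[of "1::real"] by simp
  then have "20 * (viol_prob \<Phi> * ?d) \<le> 8 * exp 1 * (viol_prob \<Phi> * ?d)"
    using viol_prob_nonneg d by (intro mult_right_mono) auto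
  also have "\<dots> \<le> p_thr \<Phi>" using lll p_thr_pos by (simp add: mult.assoc)
  finally show ?thesis using d by (simp add: field_simps)
qed

lemma frozen_viol_prob_ge:
  "c \<in> set (cons \<Phi>) \<Longrightarrow> X \<in> partial_assignments \<Phi> \<Longrightarrow> D c X \<Longrightarrow>
    0.99 * p_thr \<Phi> \<le> viol_prob_given \<Phi> X c"
  using D_oracle unfolding frozen_oracle_def by (meson not_less)

lemma not_frozen_viol_prob_le:
  "c \<in> set (cons \<Phi>) \<Longrightarrow> X \<in> partial_assignments \<Phi> \<Longrightarrow> \<not> D c X \<Longrightarrow>
    viol_prob_given \<Phi> X c \<le> p_thr \<Phi>"
  using D_oracle unfolding frozen_oracle_def by (meson not_less)

lemma frozen_cong:
  "c \<in> set (cons \<Phi>) \<Longrightarrow> X \<in> partial_assignments \<Phi> \<Longrightarrow> Y \<in> partial_assignments \<Phi> \<Longrightarrow>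
    \<forall>v\<in>vbl \<Phi> c. X v = Y v \<Longrightarrow> D c X = D c Y"
  using D_oracle unfolding frozen_oracle_def by blast

section \<open>An invariant of the process\<close>

definition admissible :: "('v \<Rightarrow> 'a pval) \<Rightarrow> bool" where
  "admissible X \<longleftrightarrow> X \<in> partial_assignments \<Phi> \<and>
     (\<forall>c\<in>set (cons \<Phi>). viol_prob_given \<Phi> X c \<le> lx / 2)"

text \<open>The last clause refers to the current assignment rather than to the one under which the
  variable was skipped. At the end it locates every unassigned variable in a constraint that is
  frozen under the final assignment.\<close>

definition reached :: "nat \<Rightarrow> ('v \<Rightarrow> 'a pval) \<Rightarrow> bool" where
  "reached i X \<longleftrightarrow> admissible X \<and>
     (\<forall>j. i \<le> j \<longrightarrow> j < nvars \<Phi> \<longrightarrow> X (vars \<Phi> ! j) = Circ) \<and>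
     (\<forall>j<i. vars \<Phi> ! j \<notin> assigned \<Phi> X \<longrightarrow> (\<exists>c\<in>set (cons \<Phi>). vars \<Phi> ! j \<in> vbl \<Phi> c \<and> D c X))"

lemma reached_0: "reached 0 (\<lambda>_. Circ)"
proof -
  have "viol_prob_given \<Phi> (\<lambda>_. Circ) c \<le> lx / 2" if "c \<in> set (cons \<Phi>)" for c
  proof -
    have "p_thr \<Phi> / (20 * real (max_deg \<Phi>) ^ 3) \<le> p_thr \<Phi> / 1"
    proof (intro divide_left_mono)
      have "1 \<le> real (max_deg \<Phi>) ^ 3" using params_ge by (intro one_le_power) simp
      then show "1 \<le> 20 * real (max_deg \<Phi>) ^ 3" by simp
    qed (use p_thr_pos params_ge in auto)
    also have "\<dots> \<le> real (max_dom \<Phi>) * p_thr \<Phi>" using p_thr_pos params_ge by simp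
    finally show ?thesis
      using viol_prob_given_Circ_le[OF that] viol_prob_le by (simp add: lx_def)
  qed
  then show ?thesis by (auto simp: reached_def admissible_def partial_assignments_def)
qed

lemma nth_in_vset: "i < nvars \<Phi> \<Longrightarrow> vars \<Phi> ! i \<in> vset \<Phi>"
  by (simp add: nvars_def)

lemma Circ_unassigned: "X u = Circ \<Longrightarrow> u \<notin> assigned \<Phi> X"
  by (auto simp: assigned_def)

lemma update_partial_assignment:
  "X \<in> partial_assignments \<Phi> \<Longrightarrow> u \<in> vset \<Phi> \<Longrightarrow> b \<in> vdom \<Phi> u \<Longrightarrow>
    X(u := Val b) \<in> partial_assignments \<Phi>"
  by (auto simp: partial_assignments_def)

lemma reached_Suc_fixed:
  assumes "reached i X" "i < nvars \<Phi>" "is_fixed \<Phi> D X (vars \<Phi> ! i)"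
  shows "reached (Suc i) X"
proof -
  have "X (vars \<Phi> ! i) = Circ" using assms by (auto simp: reached_def)
  then have "\<exists>c\<in>set (cons \<Phi>). vars \<Phi> ! i \<in> vbl \<Phi> c \<and> D c X"
    using assms(3) by (auto simp: is_fixed_def accessed_def)
  then show ?thesis using assms(1) by (auto simp: reached_def less_Suc_eq)
qed

lemma reached_Suc_update:
  assumes R: "reached i X" and i: "i < nvars \<Phi>" and nf: "\<not> is_fixed \<Phi> D X (vars \<Phi> ! i)"
    and b: "b \<in> vdom \<Phi> (vars \<Phi> ! i)"
  shows "reached (Suc i) (X(vars \<Phi> ! i := Val b))"
proof -
  define u where "u = vars \<Phi> ! i"
  define Y where "Y = X(u := Val b)"
  have u: "u \<in> vset \<Phi>" using nth_in_vset[OF i] by (simp add: u_def)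
  have una: "u \<notin> assigned \<Phi> X" using R i by (intro Circ_unassigned) (auto simp: reached_def u_def)
  have XP: "X \<in> partial_assignments \<Phi>" using R by (simp add: reached_def admissible_def)
  have YP: "Y \<in> partial_assignments \<Phi>"
    unfolding Y_def using b by (intro update_partial_assignment XP u) (simp add: u_def)
  have nfc: "\<not> D c X" if "c \<in> set (cons \<Phi>)" "u \<in> vbl \<Phi> c" for c
    using nf that by (auto simp: is_fixed_def u_def)
  have small: "viol_prob_given \<Phi> Y c \<le> lx / 2" if c: "c \<in> set (cons \<Phi>)" for c
  proof (cases "u \<in> vbl \<Phi> c")
    case True
    have "viol_prob_given \<Phi> Y c
        = real (card (vdom \<Phi> u)) * measure_pmf.prob (completion X) (violated c \<inter> {x. x u = b})"
      unfolding viol_prob_given_eq Y_def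
      using b by (intro prob_completion_update u una) (simp add: u_def)
    also have "\<dots> \<le> real (max_dom \<Phi>) * viol_prob_given \<Phi> X c"
      unfolding viol_prob_given_eq using card_vdom_le[OF u]
      by (intro mult_mono measure_pmf.finite_measure_mono) auto
    also have "\<dots> \<le> real (max_dom \<Phi>) * p_thr \<Phi>"
      by (intro mult_left_mono not_frozen_viol_prob_le c XP nfc True) simp
    finally show ?thesis by (simp add: lx_def)
  next
    case False
    then have "viol_prob_given \<Phi> Y c = viol_prob_given \<Phi> X c"
      by (intro viol_prob_given_cong c) (auto simp: Y_def)
    then show ?thesis using R c by (auto simp: reached_def admissible_def)
  qed
  have frozen: "\<exists>c\<in>set (cons \<Phi>). vars \<Phi> ! j \<in> vbl \<Phi> c \<and> D c Y"
    if j: "j < Suc i" "vars \<Phi> ! j \<notin> assigned \<Phi> Y" for j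
  proof -
    have "j \<noteq> i" using j u b by (auto simp: assigned_def Y_def u_def)
    moreover from this have "vars \<Phi> ! j \<notin> assigned \<Phi> X"
      using j una by (auto simp: assigned_def Y_def split: if_splits)
    ultimately obtain c where c: "c \<in> set (cons \<Phi>)" "vars \<Phi> ! j \<in> vbl \<Phi> c" "D c X"
      using R j(1) by (auto simp: reached_def less_Suc_eq)
    \<comment> \<open>A variable about to be assigned lies in no frozen constraint, and the oracle
      depends only on the scope, so \<open>c\<close> stays frozen.\<close>
    then have "u \<notin> vbl \<Phi> c" using nfc by blast
    then have "D c Y = D c X" by (intro frozen_cong c XP YP) (auto simp: Y_def)
    then show ?thesis using c by blast
  qed
  have "Y (vars \<Phi> ! j) = Circ" if "Suc i \<le> j" "j < nvars \<Phi>" for j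
    using R that i distinct_vars
    by (auto simp: Y_def u_def reached_def nth_eq_iff_index_eq nvars_def)
  then show ?thesis
    using YP small frozen unfolding Y_def[symmetric] u_def[symmetric]
    by (auto simp: reached_def admissible_def)
qed

lemma admissible_set_marginal:
  "admissible X \<Longrightarrow> u \<in> vset \<Phi> \<Longrightarrow> u \<notin> assigned \<Phi> X \<Longrightarrow> set_pmf (marginal \<Phi> X u) \<subseteq> vdom \<Phi> u"
  by (rule set_marginal) (auto simp: admissible_def)

lemma reached_process:
  "i \<le> nvars \<Phi> \<Longrightarrow> X \<in> set_pmf (process \<Phi> D i) \<Longrightarrow> reached i X"
proof (induction i arbitrary: X)
  case 0
  then show ?case using reached_0 by simp
next
  case (Suc i)
  obtain Y where Y: "Y \<in> set_pmf (process \<Phi> D i)"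
    and X: "X \<in> set_pmf (if is_fixed \<Phi> D Y (vars \<Phi> ! i) then return_pmf Y
       else map_pmf (\<lambda>b. Y(vars \<Phi> ! i := Val b)) (marginal \<Phi> Y (vars \<Phi> ! i)))"
    using Suc.prems by (auto simp: Let_def)
  have i: "i < nvars \<Phi>" using Suc.prems by simp
  have R: "reached i Y" using Suc.IH Y i by simp
  show ?case
  proof (cases "is_fixed \<Phi> D Y (vars \<Phi> ! i)")
    case True
    then show ?thesis using X reached_Suc_fixed[OF R i] by simp
  next
    case False
    have "set_pmf (marginal \<Phi> Y (vars \<Phi> ! i)) \<subseteq> vdom \<Phi> (vars \<Phi> ! i)"
      using R i nth_in_vset[OF i] Circ_unassigned
      by (intro admissible_set_marginal) (auto simp: reached_def)
    then show ?thesis using X False reached_Suc_update[OF R i False] by auto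
  qed
qed

section \<open>The probability that a packed set is frozen\<close>

definition growth :: real where
  "growth = 1 / (1 - real (max_deg \<Phi>) * lx)"

lemma growth_ge_1: "1 \<le> growth"
proof -
  have "0 \<le> real (max_deg \<Phi>) * lx" using lx_pos by simp
  moreover have "0 < 1 - real (max_deg \<Phi>) * lx" using mult_lx_le(1) by linarith
  ultimately show ?thesis by (simp add: growth_def)
qed

text \<open>A constraint can suffer the loss \<open>growth\<close> once per variable of its scope,
  hence at most \<open>width \<Phi>\<close> times. By Bernoulli and k \<Delta> x \<le> 1/18 the
  total loss is at most 18/17.\<close>

lemma growth_power_le: "growth ^ width \<Phi> \<le> 11/10"
proof -
  have "1 - real (width \<Phi>) * (real (max_deg \<Phi>) * lx) \<le> (1 - real (max_deg \<Phi>) * lx) ^ width \<Phi>"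
    using Bernoulli_inequality[of "- (real (max_deg \<Phi>) * lx)" "width \<Phi>"] mult_lx_le(1) by simp
  then have "17/18 \<le> (1 - real (max_deg \<Phi>) * lx) ^ width \<Phi>"
    using mult_lx_le(3) by linarith
  then have "1 / (1 - real (max_deg \<Phi>) * lx) ^ width \<Phi> \<le> 1 / (17/18)"
    by (intro divide_left_mono) auto
  then show ?thesis by (simp add: growth_def power_one_over)
qed

definition packed :: "'c set \<Rightarrow> bool" where
  "packed T \<longleftrightarrow> T \<subseteq> set (cons \<Phi>) \<and> (\<forall>c\<in>T. \<forall>d\<in>T. c \<noteq> d \<longrightarrow> \<not> share c d)"

text \<open>Under a uniform choice of \<open>b\<close>, \<open>viol_prob_given \<Phi> (X(u := Val b)) c\<close> averages to
  \<open>viol_prob_given \<Phi> X c\<close>; the marginal exceeds the uniform distribution by at most \<open>growth\<close>.\<close>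

lemma step_expectation_le:
  assumes R: "reached i X" and i: "i < nvars \<Phi>" and T: "packed T"
    and nf: "\<not> is_fixed \<Phi> D X (vars \<Phi> ! i)"
  shows "(\<integral>\<^sup>+ b. ennreal (\<Prod>c\<in>T. viol_prob_given \<Phi> (X(vars \<Phi> ! i := Val b)) c)
      \<partial>measure_pmf (marginal \<Phi> X (vars \<Phi> ! i)))
    \<le> ennreal ((if vars \<Phi> ! i \<in> (\<Union>c\<in>T. vbl \<Phi> c) then growth else 1)
        * (\<Prod>c\<in>T. viol_prob_given \<Phi> X c))"
proof -
  define u where "u = vars \<Phi> ! i"
  have u: "u \<in> vset \<Phi>" using nth_in_vset[OF i] by (simp add: u_def)
  have una: "u \<notin> assigned \<Phi> X" using R i by (intro Circ_unassigned) (auto simp: reached_def u_def)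
  have finT: "finite T" using T finite_subset by (auto simp: packed_def)
  have same: "viol_prob_given \<Phi> (X(u := Val b)) c = viol_prob_given \<Phi> X c"
    if "c \<in> T" "u \<notin> vbl \<Phi> c" for c b
    using that T by (intro viol_prob_given_cong) (auto simp: packed_def)
  show ?thesis
  proof (cases "u \<in> (\<Union>c\<in>T. vbl \<Phi> c)")
    case False
    then have "(\<Prod>c\<in>T. viol_prob_given \<Phi> (X(u := Val b)) c) = (\<Prod>c\<in>T. viol_prob_given \<Phi> X c)" for b
      by (intro prod.cong refl same) auto
    then show ?thesis using False by (simp add: u_def)
  next
    case True
    \<comment> \<open>As the scopes in \<open>T\<close> are disjoint, \<open>d\<close> is the only
      factor that the value of \<open>u\<close> can change; the others form the constant
      \<open>rest\<close>.\<close>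
    then obtain d where d: "d \<in> T" "u \<in> vbl \<Phi> d" by auto
    define rest where "rest = (\<Prod>c\<in>T - {d}. viol_prob_given \<Phi> X c)"
    have rest: "0 \<le> rest" unfolding rest_def by (intro prod_nonneg) (simp add: viol_prob_given_nonneg)
    have "(\<Prod>c\<in>T. viol_prob_given \<Phi> (X(u := Val b)) c)
        = viol_prob_given \<Phi> (X(u := Val b)) d * rest" for b
    proof -
      have "(\<Prod>c\<in>T - {d}. viol_prob_given \<Phi> (X(u := Val b)) c) = rest"
        unfolding rest_def
        by (intro prod.cong refl same) (use T d in \<open>auto simp: packed_def share_def\<close>)
      then show ?thesis using prod.remove[OF finT d(1)] by metis
    qed
    then have "(\<integral>\<^sup>+ b. ennreal (\<Prod>c\<in>T. viol_prob_given \<Phi> (X(u := Val b)) c)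
          \<partial>measure_pmf (marginal \<Phi> X u))
        = (\<integral>\<^sup>+ b. ennreal (viol_prob_given \<Phi> (X(u := Val b)) d * rest)
          \<partial>measure_pmf (marginal \<Phi> X u))" by simp
    also have "\<dots> \<le> ennreal ((\<Sum>b\<in>vdom \<Phi> u. viol_prob_given \<Phi> (X(u := Val b)) d * rest)
        / real (card (vdom \<Phi> u)) / (1 - real (max_deg \<Phi>) * lx))"
      using R rest viol_prob_given_nonneg
      by (intro nn_integral_marginal_le u una) (auto simp: reached_def admissible_def)
    also have "(\<Sum>b\<in>vdom \<Phi> u. viol_prob_given \<Phi> (X(u := Val b)) d * rest)
        = real (card (vdom \<Phi> u)) * viol_prob_given \<Phi> X d * rest"
      unfolding viol_prob_given_eq sum_distrib_right[symmetric]
      by (simp add: sum_prob_completion_update u una)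
    also have "real (card (vdom \<Phi> u)) * viol_prob_given \<Phi> X d * rest / real (card (vdom \<Phi> u))
          / (1 - real (max_deg \<Phi>) * lx)
        = growth * (viol_prob_given \<Phi> X d * rest)"
      using card_vdom[OF u] by (auto simp: growth_def)
    also have "viol_prob_given \<Phi> X d * rest = (\<Prod>c\<in>T. viol_prob_given \<Phi> X c)"
      unfolding rest_def using prod.remove[OF finT d(1)] by metis
    finally show ?thesis unfolding u_def[symmetric] if_P[OF True] .
  qed
qed

text \<open>The exponent counts the variables of the scopes that have had their turn. Each has
  exactly one turn; one that is skipped leaves the product unchanged, which is covered by
  \<open>growth\<close> being at least 1.\<close>

lemma process_expectation_le:
  assumes T: "packed T"
  shows "i \<le> nvars \<Phi> \<Longrightarrow>
    (\<integral>\<^sup>+ X. ennreal (\<Prod>c\<in>T. viol_prob_given \<Phi> X c) \<partial>measure_pmf (process \<Phi> D i))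
    \<le> ennreal (growth ^ card ((\<Union>c\<in>T. vbl \<Phi> c) \<inter> set (take i (vars \<Phi>)))
        * (\<Prod>c\<in>T. viol_prob_given \<Phi> (\<lambda>_. Circ) c))"
proof (induction i)
  case 0
  then show ?case by simp
next
  case (Suc i)
  let ?W = "\<Union>c\<in>T. vbl \<Phi> c"
  let ?M = "\<lambda>X. \<Prod>c\<in>T. viol_prob_given \<Phi> X c"
  let ?u = "vars \<Phi> ! i"
  define g where "g = (if ?u \<in> ?W then growth else 1)"
  have g: "1 \<le> g" using growth_ge_1 by (simp add: g_def)
  have M: "0 \<le> ?M X" for X by (intro prod_nonneg) (simp add: viol_prob_given_nonneg)
  have i: "i < nvars \<Phi>" using Suc.prems by simp
  have "(\<integral>\<^sup>+ X. ennreal (?M X) \<partial>measure_pmf (process \<Phi> D (Suc i)))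
      = (\<integral>\<^sup>+ X. (\<integral>\<^sup>+ Y. ennreal (?M Y) \<partial>measure_pmf
          (if is_fixed \<Phi> D X ?u then return_pmf X
           else map_pmf (\<lambda>b. X(?u := Val b)) (marginal \<Phi> X ?u))) \<partial>measure_pmf (process \<Phi> D i))"
    by (simp add: Let_def)
  also have "\<dots> \<le> (\<integral>\<^sup>+ X. ennreal g * ennreal (?M X) \<partial>measure_pmf (process \<Phi> D i))"
  proof (rule nn_integral_mono_AE, unfold AE_measure_pmf_iff, intro ballI)
    fix X assume "X \<in> set_pmf (process \<Phi> D i)"
    then have R: "reached i X" using reached_process i by simp
    show "(\<integral>\<^sup>+ Y. ennreal (?M Y) \<partial>measure_pmf (if is_fixed \<Phi> D X ?u then return_pmf X
           else map_pmf (\<lambda>b. X(?u := Val b)) (marginal \<Phi> X ?u))) \<le> ennreal g * ennreal (?M X)"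
    proof (cases "is_fixed \<Phi> D X ?u")
      case True
      have "ennreal (?M X) \<le> ennreal (g * ?M X)"
        using g M[of X] mult_right_mono[of 1 g "?M X"] by (intro ennreal_leI) simp
      then show ?thesis using True g M by (simp add: ennreal_mult)
    next
      case False
      then show ?thesis
        using step_expectation_le[OF R i T False] g M by (simp add: g_def ennreal_mult)
    qed
  qed
  also have "\<dots> = ennreal g * (\<integral>\<^sup>+ X. ennreal (?M X) \<partial>measure_pmf (process \<Phi> D i))"
    by (rule nn_integral_cmult) simp
  also have "\<dots> \<le> ennreal g * ennreal (growth ^ card (?W \<inter> set (take i (vars \<Phi>))) * ?M (\<lambda>_. Circ))"
    using Suc.IH i by (intro mult_left_mono) auto
  also have "\<dots> = ennreal (g * growth ^ card (?W \<inter> set (take i (vars \<Phi>))) * ?M (\<lambda>_. Circ))"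
    using g growth_ge_1 M by (simp add: ennreal_mult mult.assoc)
  also have "g * growth ^ card (?W \<inter> set (take i (vars \<Phi>)))
      = growth ^ card (?W \<inter> set (take (Suc i) (vars \<Phi>)))"
  proof -
    have take: "set (take (Suc i) (vars \<Phi>)) = insert ?u (set (take i (vars \<Phi>)))"
      using i by (simp add: take_Suc_conv_app_nth nvars_def)
    have "?u \<notin> set (take i (vars \<Phi>))"
      using i distinct_vars by (auto simp: in_set_conv_nth nth_eq_iff_index_eq nvars_def)
    then show ?thesis unfolding take by (simp add: g_def)
  qed
  finally show ?case .
qed

lemma all_frozen_prob_le:
  assumes T: "packed T"
  shows "(\<integral>\<^sup>+ X. of_bool (\<forall>c\<in>T. D c X) \<partial>measure_pmf (process \<Phi> D (nvars \<Phi>)))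
    \<le> ennreal ((1 / (16 * real (max_deg \<Phi>) ^ 3)) ^ card T)"
proof -
  let ?W = "\<Union>c\<in>T. vbl \<Phi> c"
  let ?M = "\<lambda>X. \<Prod>c\<in>T. viol_prob_given \<Phi> X c"
  define thr where "thr = 0.99 * p_thr \<Phi>"
  have thr: "0 < thr" using p_thr_pos by (simp add: thr_def)
  have finT: "finite T" and TC: "T \<subseteq> set (cons \<Phi>)" using T finite_subset by (auto simp: packed_def)
  have M: "0 \<le> ?M X" for X by (intro prod_nonneg) (simp add: viol_prob_given_nonneg)
  have "(\<integral>\<^sup>+ X. of_bool (\<forall>c\<in>T. D c X) \<partial>measure_pmf (process \<Phi> D (nvars \<Phi>)))
      \<le> (\<integral>\<^sup>+ X. ennreal (1 / thr ^ card T) * ennreal (?M X) \<partial>measure_pmf (process \<Phi> D (nvars \<Phi>)))"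
  proof (rule nn_integral_mono_AE, unfold AE_measure_pmf_iff, intro ballI)
    fix X assume "X \<in> set_pmf (process \<Phi> D (nvars \<Phi>))"
    then have X: "X \<in> partial_assignments \<Phi>"
      using reached_process by (auto simp: reached_def admissible_def)
    show "of_bool (\<forall>c\<in>T. D c X) \<le> ennreal (1 / thr ^ card T) * ennreal (?M X)"
    proof (cases "\<forall>c\<in>T. D c X")
      case True
      then have "thr ^ card T \<le> ?M X"
        unfolding prod_constant[symmetric] thr_def
        using frozen_viol_prob_ge X TC p_thr_pos by (intro prod_mono) auto
      then have "1 \<le> 1 / thr ^ card T * ?M X" using thr by (simp add: field_simps)
      then have "ennreal 1 \<le> ennreal (1 / thr ^ card T * ?M X)" by (rule ennreal_leI)
      also have "\<dots> = ennreal (1 / thr ^ card T) * ennreal (?M X)"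
        using thr M by (intro ennreal_mult) auto
      finally show ?thesis using True by simp
    qed auto
  qed
  also have "\<dots> = ennreal (1 / thr ^ card T) * (\<integral>\<^sup>+ X. ennreal (?M X) \<partial>measure_pmf (process \<Phi> D (nvars \<Phi>)))"
    by (rule nn_integral_cmult) simp
  also have "\<dots> \<le> ennreal (1 / thr ^ card T)
      * ennreal (growth ^ card (?W \<inter> set (take (nvars \<Phi>) (vars \<Phi>))) * ?M (\<lambda>_. Circ))"
    by (intro mult_left_mono process_expectation_le T) auto
  also have "\<dots> = ennreal (1 / thr ^ card T
      * (growth ^ card (?W \<inter> set (take (nvars \<Phi>) (vars \<Phi>))) * ?M (\<lambda>_. Circ)))"
    using thr growth_ge_1 M by (intro ennreal_mult[symmetric]) auto
  also have "\<dots> \<le> ennreal (1 / thr ^ card T * ((11/10) ^ card T * viol_prob \<Phi> ^ card T))"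
  proof (intro ennreal_leI mult_left_mono mult_mono)
    have "card (?W \<inter> set (take (nvars \<Phi>) (vars \<Phi>))) \<le> card ?W"
      using finT TC finite_vbl by (intro card_mono) auto
    also have "\<dots> \<le> (\<Sum>c\<in>T. card (vbl \<Phi> c))" by (rule card_UN_le[OF finT])
    also have "\<dots> \<le> width \<Phi> * card T"
      using sum_bounded_above[of T "\<lambda>c. card (vbl \<Phi> c)" "width \<Phi>"] card_vbl_le TC
      by (auto simp: mult.commute)
    finally have "growth ^ card (?W \<inter> set (take (nvars \<Phi>) (vars \<Phi>))) \<le> (growth ^ width \<Phi>) ^ card T"
      unfolding power_mult[symmetric] using growth_ge_1 by (intro power_increasing)
    also have "\<dots> \<le> (11/10) ^ card T"
      using growth_ge_1 by (intro power_mono growth_power_le) auto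
    finally show "growth ^ card (?W \<inter> set (take (nvars \<Phi>) (vars \<Phi>))) \<le> (11/10) ^ card T" .
    show "?M (\<lambda>_. Circ) \<le> viol_prob \<Phi> ^ card T"
      unfolding prod_constant[symmetric]
      using viol_prob_given_Circ_le viol_prob_given_nonneg TC by (intro prod_mono) auto
  qed (use thr M in auto)
  also have "1 / thr ^ card T * ((11/10) ^ card T * viol_prob \<Phi> ^ card T)
      = (11/10 * viol_prob \<Phi> / thr) ^ card T"
    by (simp add: power_mult_distrib power_divide)
  also have "ennreal \<dots> \<le> ennreal ((1 / (16 * real (max_deg \<Phi>) ^ 3)) ^ card T)"
  proof (intro ennreal_leI power_mono)
    \<comment> \<open>The slack 0.99 of the oracle turns 20 into 19.8, and 11/10 * 1/19.8 = 1/18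
      lies below 1/16.\<close>
    have "viol_prob \<Phi> / thr \<le> p_thr \<Phi> / (20 * real (max_deg \<Phi>) ^ 3) / thr"
      using thr by (intro divide_right_mono viol_prob_le) auto
    also have "\<dots> = 1 / (19.8 * real (max_deg \<Phi>) ^ 3)"
      using p_thr_pos by (simp add: thr_def)
    finally have "11/10 * viol_prob \<Phi> / thr \<le> 11/10 * (1 / (19.8 * real (max_deg \<Phi>) ^ 3))" by simp
    also have "\<dots> \<le> 1 / (16 * real (max_deg \<Phi>) ^ 3)"
      using params_ge by (simp add: field_simps)
    finally show "11/10 * viol_prob \<Phi> / thr \<le> 1 / (16 * real (max_deg \<Phi>) ^ 3)" .
  qed (use thr viol_prob_nonneg in auto)
  finally show ?thesis .
qed

end

section \<open>Cost of rejection sampling\<close>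

lemma draw_seq: "draw P ;; f = bind_pmf P f"
proof -
  have "map_spmf (\<lambda>(y, nq', nt'). (y, 0 + nq', 0 + nt')) p = p" for p :: "'b prog"
    by (simp add: case_prod_beta)
  then show ?thesis
    by (simp add: draw_def seq_def bind_spmf_def bind_map_pmf)
qed

lemma wp_foldp_le:
  assumes "\<And>b s. b \<in> set bs \<Longrightarrow> wp \<alpha> \<beta> (f b s) (\<lambda>_. 0) \<le> w b"
  shows "wp \<alpha> \<beta> (foldp f bs s) (\<lambda>_. 0) \<le> sum_list (map w bs)"
  using assms
proof (induction bs arbitrary: s)
  case Nil
  show ?case by simp
next
  case (Cons b bs)
  have "wp \<alpha> \<beta> (foldp f (b # bs) s) (\<lambda>_. 0) \<le> wp \<alpha> \<beta> (f b s) (\<lambda>_. sum_list (map w bs))"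
    unfolding foldp.simps wp_seq using Cons by (intro wp_mono) auto
  also have "\<dots> = wp \<alpha> \<beta> (f b s) (\<lambda>_. 0) + sum_list (map w bs)" by (rule wp_add_const)
  also have "\<dots> \<le> w b + sum_list (map w bs)" using Cons.prems by (intro add_right_mono) auto
  finally show ?case by simp
qed

context csp_formula
begin

lemma query_eq:
  "c \<in> set (cons \<Phi>) \<Longrightarrow> query a \<Phi> X c = return_spmf (satisfied_by \<Phi> X c, 1, a * width \<Phi>)"
  unfolding query_def
  by (subst charge_seq_return[where nq' = 0 and nt' = 0]) (auto simp: ret_def satisfied_by_restrict)

lemma visit_eq:
  assumes c: "c \<in> set (cons \<Phi>)"
  shows "visit a \<Phi> X c (todo, us, cs) = return_spmf
    (if satisfied_by \<Phi> X c then ((todo, us, cs), 1, a * width \<Phi>)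
     else let new = filter (\<lambda>w. w \<notin> set us) (hyperedge \<Phi> X c)
       in ((new @ todo, new @ us, List.insert c cs), 1, 2 * (a * width \<Phi>)))"
  unfolding visit_def
  by (simp add: query_eq[OF c] seq_return_spmf ret_def charge_def Let_def)

text \<open>The search draws nothing at random, so the program equals a single outcome and its cost
  is computed outright instead of in expectation. A visit makes one query and charges
  \<open>a * width \<Phi>\<close> at most twice.\<close>

lemma foldp_visit:
  assumes "set L \<subseteq> set (cons \<Phi>)"
  shows "\<exists>new cs' nt. foldp (visit a \<Phi> X) L (todo, us, cs)
      = return_spmf ((new @ todo, new @ us, cs'), length L, nt) \<and>
    nt \<le> 2 * (a * width \<Phi>) * length L \<and> distinct new \<and> set new \<inter> set us = {} \<and>
    set (new @ us) = set us \<union> (\<Union>c\<in>{c \<in> set L. \<not> satisfied_by \<Phi> X c}. set (hyperedge \<Phi> X c)) \<and>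
    set cs' = set cs \<union> {c \<in> set L. \<not> satisfied_by \<Phi> X c} \<and> (distinct cs \<longrightarrow> distinct cs')"
  using assms
proof (induction L arbitrary: todo us cs)
  case Nil
  show ?case by (simp add: ret_def)
next
  case (Cons c L)
  have c: "c \<in> set (cons \<Phi>)" and L: "set L \<subseteq> set (cons \<Phi>)" using Cons.prems by auto
  show ?case
  proof (cases "satisfied_by \<Phi> X c")
    case True
    obtain new cs' nt where IH: "foldp (visit a \<Phi> X) L (todo, us, cs)
        = return_spmf ((new @ todo, new @ us, cs'), length L, nt)"
      "nt \<le> 2 * (a * width \<Phi>) * length L" "distinct new" "set new \<inter> set us = {}"
      "set (new @ us) = set us \<union> (\<Union>c\<in>{c \<in> set L. \<not> satisfied_by \<Phi> X c}. set (hyperedge \<Phi> X c))"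
      "set cs' = set cs \<union> {c \<in> set L. \<not> satisfied_by \<Phi> X c}" "distinct cs \<longrightarrow> distinct cs'"
      using Cons.IH[OF L] by meson
    have "foldp (visit a \<Phi> X) (c # L) (todo, us, cs)
        = return_spmf ((new @ todo, new @ us, cs'), length (c # L), a * width \<Phi> + nt)"
      using True by (simp add: visit_eq[OF c] seq_return_spmf IH(1))
    moreover have "{d \<in> set (c # L). \<not> satisfied_by \<Phi> X d} = {d \<in> set L. \<not> satisfied_by \<Phi> X d}"
      using True by auto
    ultimately show ?thesis
      using IH by (intro exI[of _ new] exI[of _ cs'] exI[of _ "a * width \<Phi> + nt"]) simp
  next
    case False
    define new1 where "new1 = filter (\<lambda>w. w \<notin> set us) (hyperedge \<Phi> X c)"
    obtain new cs' nt where IH: "foldp (visit a \<Phi> X) L (new1 @ todo, new1 @ us, List.insert c cs)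
        = return_spmf ((new @ new1 @ todo, new @ new1 @ us, cs'), length L, nt)"
      "nt \<le> 2 * (a * width \<Phi>) * length L" "distinct new" "set new \<inter> set (new1 @ us) = {}"
      "set (new @ new1 @ us) = set (new1 @ us)
        \<union> (\<Union>c\<in>{c \<in> set L. \<not> satisfied_by \<Phi> X c}. set (hyperedge \<Phi> X c))"
      "set cs' = set (List.insert c cs) \<union> {c \<in> set L. \<not> satisfied_by \<Phi> X c}"
      "distinct (List.insert c cs) \<longrightarrow> distinct cs'"
      using Cons.IH[OF L] by meson
    have "foldp (visit a \<Phi> X) (c # L) (todo, us, cs)
        = return_spmf (((new @ new1) @ todo, (new @ new1) @ us, cs'), length (c # L),
            2 * (a * width \<Phi>) + nt)"
      using False
      by (simp add: visit_eq[OF c] seq_return_spmf IH(1) Let_def new1_def[symmetric])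
    moreover have "{d \<in> set (c # L). \<not> satisfied_by \<Phi> X d}
        = insert c {d \<in> set L. \<not> satisfied_by \<Phi> X d}"
      using False by auto
    moreover have "distinct new1"
      unfolding new1_def hyperedge_def using distinct_vars by simp
    moreover have "set new1 \<inter> set us = {}" "set new1 \<union> set us = set us \<union> set (hyperedge \<Phi> X c)"
      by (auto simp: new1_def)
    ultimately show ?thesis
      using IH
      by (intro exI[of _ "new @ new1"] exI[of _ cs'] exI[of _ "2 * (a * width \<Phi>) + nt"]) auto
  qed
qed

section \<open>Connected components and the graph search\<close>

definition linked :: "('v \<Rightarrow> 'a pval) \<Rightarrow> 'v \<Rightarrow> 'v \<Rightarrow> bool" where
  "linked X u w \<longleftrightarrow> (\<exists>c\<in>set (cons \<Phi>). \<not> satisfied_by \<Phi> X c \<and>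
     u \<in> vbl \<Phi> c - assigned \<Phi> X \<and> w \<in> vbl \<Phi> c - assigned \<Phi> X)"

definition component :: "('v \<Rightarrow> 'a pval) \<Rightarrow> 'v \<Rightarrow> 'v set" where
  "component X v = {w. (linked X)\<^sup>*\<^sup>* v w}"

definition edges :: "('v \<Rightarrow> 'a pval) \<Rightarrow> 'v set \<Rightarrow> 'c set" where
  "edges X U = {c \<in> set (cons \<Phi>). \<not> satisfied_by \<Phi> X c \<and> vbl \<Phi> c \<inter> U \<noteq> {}}"

lemma linked_sym: "linked X u w \<Longrightarrow> linked X w u"
  by (auto simp: linked_def)

lemma component_refl: "v \<in> component X v"
  by (simp add: component_def)

lemma component_step: "u \<in> component X v \<Longrightarrow> linked X u w \<Longrightarrow> w \<in> component X v"
  unfolding component_def by (auto intro: rtranclp.rtrancl_into_rtrancl)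

lemma component_subset_closed:
  assumes "v \<in> U" "\<And>u w. u \<in> U \<Longrightarrow> linked X u w \<Longrightarrow> w \<in> U"
  shows "component X v \<subseteq> U"
proof
  fix w assume "w \<in> component X v"
  then have "(linked X)\<^sup>*\<^sup>* v w" by (simp add: component_def)
  then show "w \<in> U" by induction (use assms in auto)
qed

lemma component_disjoint:
  assumes "v \<notin> component X v'"
  shows "component X v \<inter> component X v' = {}"
proof -
  have "component X v \<subseteq> - component X v'"
    by (rule component_subset_closed) (use assms linked_sym component_step in blast)+
  then show ?thesis by auto
qed

lemma component_subset:
  assumes "v \<in> vset \<Phi> - assigned \<Phi> X"
  shows "component X v \<subseteq> vset \<Phi> - assigned \<Phi> X"
  using assms by (rule component_subset_closed) (use vbl_subset in \<open>auto simp: linked_def\<close>)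

definition search_state ::
    "('v \<Rightarrow> 'a pval) \<Rightarrow> 'v \<Rightarrow> 'v list \<Rightarrow> 'v list \<Rightarrow> 'c list \<Rightarrow> bool" where
  "search_state X v todo us cs \<longleftrightarrow> distinct us \<and> distinct todo \<and> set todo \<subseteq> set us \<and>
     v \<in> set us \<and> set us \<subseteq> component X v \<and> distinct cs \<and> set cs = edges X (set us - set todo) \<and>
     (\<forall>u\<in>set us - set todo. \<forall>w. linked X u w \<longrightarrow> w \<in> set us)"

lemma search_state_final:
  assumes "search_state X v [] us cs"
  shows "set us = component X v" "set cs = edges X (set us)" "distinct us" "distinct cs"
  using assms component_subset_closed[of v "set us" X] by (auto simp: search_state_def)

lemma search_state_expand:
  assumes st: "search_state X v (u # todo) us cs" and v: "v \<in> vset \<Phi> - assigned \<Phi> X"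
    and new: "distinct new" "set new \<inter> set us = {}"
    and us: "set (new @ us) = set us \<union>
      (\<Union>c\<in>{c \<in> set (cons \<Phi>). u \<in> vbl \<Phi> c \<and> \<not> satisfied_by \<Phi> X c}. set (hyperedge \<Phi> X c))"
    and cs: "set cs' = set cs \<union> {c \<in> set (cons \<Phi>). u \<in> vbl \<Phi> c \<and> \<not> satisfied_by \<Phi> X c}" "distinct cs'"
  shows "search_state X v (new @ todo) (new @ us) cs'"
    and "set (new @ us) - set (new @ todo) = insert u (set us - set (u # todo))"
proof -
  show expanded: "set (new @ us) - set (new @ todo) = insert u (set us - set (u # todo))"
    using st new by (auto simp: search_state_def)
  have uc: "u \<in> component X v" "u \<notin> assigned \<Phi> X"
    using st component_subset[OF v] by (auto simp: search_state_def)
  have hyper: "set (hyperedge \<Phi> X c) = vbl \<Phi> c - assigned \<Phi> X" if "c \<in> set (cons \<Phi>)" for c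
    using vbl_subset[OF that] by (auto simp: hyperedge_def)
  have link: "w \<in> set (new @ us)" if "linked X u w" for w
    using that us hyper by (auto simp: linked_def)
  have reach: "w \<in> component X v" if w: "w \<in> set (new @ us)" for w
  proof (cases "w \<in> set us")
    case True
    then show ?thesis using st by (auto simp: search_state_def)
  next
    case False
    then have "linked X u w" using w us hyper uc by (auto simp: linked_def)
    then show ?thesis using component_step uc by blast
  qed
  have found: "set cs' = edges X (insert u (set us - set (u # todo)))"
    using cs st by (auto simp: search_state_def edges_def)
  have old: "w \<in> set us" if "u' \<in> set us - set (u # todo)" "linked X u' w" for u' w
    using st that unfolding search_state_def by blast
  show "search_state X v (new @ todo) (new @ us) cs'"
    unfolding search_state_def expanded
  proof (intro conjI found cs(2))
    show "\<forall>u'\<in>insert u (set us - set (u # todo)). \<forall>w. linked X u' w \<longrightarrow> w \<in> set (new @ us)"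
    proof (intro ballI allI impI)
      fix u' w assume "u' \<in> insert u (set us - set (u # todo))" "linked X u' w"
      then show "w \<in> set (new @ us)"
        using link[of w] old[of u' w] by (cases "u' = u") auto
    qed
    show "set (new @ us) \<subseteq> component X v" using reach by blast
  qed (use st new in \<open>auto simp: search_state_def\<close>)
qed

text \<open>A potential argument: an expanded vertex accounts for at most
  \<open>max_deg \<Phi>\<close> queries and three units of
  \<open>a * width \<Phi> * max_deg \<Phi>\<close>, one for retrieving its constraints and two for
  visiting them. The terms added on the left credit vertices expanded before the call. The same
  induction gives termination, since each call expands a new vertex of a finite component.\<close>

lemma explore_cost:
  assumes v: "v \<in> vset \<Phi> - assigned \<Phi> X"
  shows "search_state X v todo us cs \<Longrightarrow> \<exists>us' cs' nq nt.
    explore a \<Phi> X (todo, us, cs) = return_spmf ((us', cs'), nq, nt) \<and>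
    search_state X v [] us' cs' \<and>
    nq + max_deg \<Phi> * card (set us - set todo) \<le> max_deg \<Phi> * length us' \<and>
    nt + 3 * (a * width \<Phi> * max_deg \<Phi>) * card (set us - set todo)
      \<le> 3 * (a * width \<Phi> * max_deg \<Phi>) * length us'"
proof (induction "card (component X v - (set us - set todo))" arbitrary: todo us cs rule: less_induct)
  case less
  show ?case
  proof (cases todo)
    case Nil
    then have "explore a \<Phi> X (todo, us, cs) = return_spmf ((us, cs), 0, 0)"
      by (subst explore.simps) (simp add: ret_def)
    moreover have "card (set us) = length us"
      using less.prems by (intro distinct_card) (simp add: search_state_def)
    ultimately show ?thesis
      using less.prems Nil by (intro exI[of _ us] exI[of _ cs] exI[of _ 0]) simp
  next
    case (Cons u todo')
    define L where "L = filter (\<lambda>c. u \<in> vbl \<Phi> c) (cons \<Phi>)"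
    have L: "set L \<subseteq> set (cons \<Phi>)" by (auto simp: L_def)
    have "length L = card (set L)"
      unfolding L_def using distinct_cons by (intro distinct_card[symmetric]) simp
    then have lenL: "length L \<le> max_deg \<Phi>"
      using card_containing_le[of u] by (simp add: L_def)
    obtain new cs' nt where f: "foldp (visit a \<Phi> X) L (todo', us, cs)
        = return_spmf ((new @ todo', new @ us, cs'), length L, nt)"
      "nt \<le> 2 * (a * width \<Phi>) * length L" "distinct new" "set new \<inter> set us = {}"
      "set (new @ us) = set us \<union> (\<Union>c\<in>{c \<in> set L. \<not> satisfied_by \<Phi> X c}. set (hyperedge \<Phi> X c))"
      "set cs' = set cs \<union> {c \<in> set L. \<not> satisfied_by \<Phi> X c}" "distinct cs \<longrightarrow> distinct cs'"
      using foldp_visit[OF L] by meson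
    have st: "search_state X v (u # todo') us cs" using less.prems Cons by simp
    have setL: "{c \<in> set L. \<not> satisfied_by \<Phi> X c}
        = {c \<in> set (cons \<Phi>). u \<in> vbl \<Phi> c \<and> \<not> satisfied_by \<Phi> X c}" by (auto simp: L_def)
    have "distinct cs'" using f(7) st by (simp add: search_state_def)
    note step = search_state_expand[OF st v f(3,4) f(5)[unfolded setL] f(6)[unfolded setL] this]
    let ?done = "set us - set (u # todo')"
    let ?done' = "set (new @ us) - set (new @ todo')"
    have u: "u \<in> component X v" "u \<notin> ?done" using st by (auto simp: search_state_def)
    have fin: "finite (component X v)"
      using component_subset[OF v] finite_subset by blast
    have "component X v - ?done' \<subset> component X v - ?done"
      unfolding step(2) using u by auto
    then have "card (component X v - ?done') < card (component X v - (set us - set todo))"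
      unfolding Cons using fin by (intro psubset_card_mono) auto
    from less.hyps[OF this step(1)] obtain us2 cs2 nq2 nt2 where r:
      "explore a \<Phi> X (new @ todo', new @ us, cs') = return_spmf ((us2, cs2), nq2, nt2)"
      "search_state X v [] us2 cs2"
      "nq2 + max_deg \<Phi> * card ?done' \<le> max_deg \<Phi> * length us2"
      "nt2 + 3 * (a * width \<Phi> * max_deg \<Phi>) * card ?done'
        \<le> 3 * (a * width \<Phi> * max_deg \<Phi>) * length us2"
      by blast
    have card': "card ?done' = Suc (card ?done)"
      unfolding step(2) using u(2) by (intro card_insert_disjoint) auto
    have "explore a \<Phi> X (todo, us, cs)
        = return_spmf ((us2, cs2), length L + nq2, a * max_deg \<Phi> + (nt + nt2))"
      unfolding Cons
      by (subst explore.simps)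
        (simp add: charge_def seq_return_spmf f(1) r(1) L_def[symmetric])
    moreover have "length L + nq2 + max_deg \<Phi> * card ?done \<le> max_deg \<Phi> * length us2"
      using r(3) lenL unfolding card' by simp
    moreover have "a * max_deg \<Phi> + (nt + nt2) + 3 * (a * width \<Phi> * max_deg \<Phi>) * card ?done
        \<le> 3 * (a * width \<Phi> * max_deg \<Phi>) * length us2"
    proof -
      have "nt \<le> 2 * (a * width \<Phi> * max_deg \<Phi>)"
        using f(2) mult_le_mono2[OF lenL, of "2 * (a * width \<Phi>)"] by (simp only: mult.assoc)
      moreover have "a * max_deg \<Phi> * 1 \<le> a * max_deg \<Phi> * width \<Phi>"
        using params_ge by (intro mult_left_mono) auto
      then have "a * max_deg \<Phi> \<le> a * width \<Phi> * max_deg \<Phi>" by (simp add: ac_simps)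
      ultimately show ?thesis using r(4) unfolding card' mult_Suc_right by linarith
    qed
    ultimately show ?thesis using r(2) unfolding Cons by blast
  qed
qed

lemma explore_start:
  assumes v: "v \<in> vset \<Phi> - assigned \<Phi> X"
  shows "\<exists>us cs nq nt. explore a \<Phi> X ([v], [v], []) = return_spmf ((us, cs), nq, nt) \<and>
    set us = component X v \<and> set cs = edges X (set us) \<and> distinct us \<and> distinct cs \<and>
    nq \<le> max_deg \<Phi> * length us \<and> nt \<le> 3 * (a * width \<Phi> * max_deg \<Phi>) * length us"
proof -
  have "search_state X v [v] [v] []"
    by (simp add: search_state_def edges_def component_refl)
  from explore_cost[OF v this] show ?thesis
    using search_state_final by (metis add_leD1)
qed

definition search_result :: "('v \<Rightarrow> 'a pval) \<Rightarrow> ('v list \<times> 'c list) list \<Rightarrow> bool" where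
  "search_result X comps \<longleftrightarrow> distinct (concat (map fst comps)) \<and>
     (\<forall>(us, cs)\<in>set comps. (\<exists>v\<in>vset \<Phi> - assigned \<Phi> X. set us = component X v) \<and>
        set cs = edges X (set us) \<and> distinct us \<and> distinct cs)"

lemma search_resultD:
  assumes "search_result X comps" "(us, cs) \<in> set comps"
  shows "\<exists>v\<in>vset \<Phi> - assigned \<Phi> X. set us = component X v"
    "set cs = edges X (set us)" "distinct us" "distinct cs"
  using bspec[OF assms(1)[unfolded search_result_def, THEN conjunct2] assms(2)] by simp_all

text \<open>The same amortisation, with the total length of the components found so far as
  potential. A vertex in none of them starts a component disjoint from all of them, so no vertex is
  paid for twice; \<open>a * length vs\<close> pays for the membership tests.\<close>

lemma foldp_components:
  assumes "set vs \<subseteq> vset \<Phi> - assigned \<Phi> X" "search_result X comps"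
  shows "\<exists>comps' nq nt. foldp (\<lambda>v comps.
       charge 0 a ;; (\<lambda>_.
       if \<exists>(us, cs)\<in>set comps. v \<in> set us then ret comps
       else explore a \<Phi> X ([v], [v], []) ;; (\<lambda>comp. ret (comp # comps)))) vs comps
      = return_spmf (comps', nq, nt) \<and> search_result X comps' \<and>
    nq + max_deg \<Phi> * length (concat (map fst comps)) \<le> max_deg \<Phi> * length (concat (map fst comps')) \<and>
    nt + 3 * (a * width \<Phi> * max_deg \<Phi>) * length (concat (map fst comps))
      \<le> 3 * (a * width \<Phi> * max_deg \<Phi>) * length (concat (map fst comps')) + a * length vs"
  (is "\<exists>comps' nq nt. foldp ?f vs comps = _ \<and> _")
  using assms
proof (induction vs arbitrary: comps)
  case Nil
  then show ?case by (intro exI[of _ comps] exI[of _ 0]) (simp add: ret_def)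
next
  case (Cons v vs)
  have v: "v \<in> vset \<Phi> - assigned \<Phi> X" and vs: "set vs \<subseteq> vset \<Phi> - assigned \<Phi> X"
    using Cons.prems by auto
  show ?case
  proof (cases "\<exists>(us, cs)\<in>set comps. v \<in> set us")
    case True
    obtain comps' nq nt where IH: "foldp ?f vs comps = return_spmf (comps', nq, nt)"
      "search_result X comps'"
      "nq + max_deg \<Phi> * length (concat (map fst comps)) \<le> max_deg \<Phi> * length (concat (map fst comps'))"
      "nt + 3 * (a * width \<Phi> * max_deg \<Phi>) * length (concat (map fst comps))
        \<le> 3 * (a * width \<Phi> * max_deg \<Phi>) * length (concat (map fst comps')) + a * length vs"
      using Cons.IH[OF vs Cons.prems(2)] by blast
    have "?f v comps = return_spmf (comps, 0, a)"
      using True by (simp add: charge_def seq_return_spmf ret_def)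
    then have "foldp ?f (v # vs) comps = return_spmf (comps', nq, a + nt)"
      by (simp only: foldp.simps seq_return_spmf IH(1)) simp
    then show ?thesis
      using IH by (intro exI[of _ comps'] exI[of _ nq] exI[of _ "a + nt"]) simp
  next
    case False
    obtain us cs nq1 nt1 where e: "explore a \<Phi> X ([v], [v], []) = return_spmf ((us, cs), nq1, nt1)"
      "set us = component X v" "set cs = edges X (set us)" "distinct us" "distinct cs"
      "nq1 \<le> max_deg \<Phi> * length us" "nt1 \<le> 3 * (a * width \<Phi> * max_deg \<Phi>) * length us"
      using explore_start[OF v] by blast
    have "set us \<inter> set us' = {}" if mem: "(us', cs') \<in> set comps" for us' cs'
    proof -
      obtain v' where "set us' = component X v'"
        using search_resultD(1)[OF Cons.prems(2) mem] by blast
      moreover have "v \<notin> set us'" using False mem by auto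
      ultimately show ?thesis using component_disjoint e(2) by metis
    qed
    then have "set us \<inter> set (concat (map fst comps)) = {}" by fastforce
    then have "search_result X ((us, cs) # comps)"
      using Cons.prems(2) e v unfolding search_result_def by auto
    from Cons.IH[OF vs this] obtain comps' nq nt where
      IH: "foldp ?f vs ((us, cs) # comps) = return_spmf (comps', nq, nt)"
      "search_result X comps'"
      "nq + max_deg \<Phi> * length (concat (map fst ((us, cs) # comps)))
        \<le> max_deg \<Phi> * length (concat (map fst comps'))"
      "nt + 3 * (a * width \<Phi> * max_deg \<Phi>) * length (concat (map fst ((us, cs) # comps)))
        \<le> 3 * (a * width \<Phi> * max_deg \<Phi>) * length (concat (map fst comps')) + a * length vs"
      by blast
    have "?f v comps = return_spmf ((us, cs) # comps, nq1, a + nt1)"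
      using False by (simp add: charge_def seq_return_spmf ret_def e(1))
    then have "foldp ?f (v # vs) comps = return_spmf (comps', nq1 + nq, (a + nt1) + nt)"
      by (simp only: foldp.simps seq_return_spmf IH(1)) simp
    then show ?thesis
      using IH e(6,7)
      by (intro exI[of _ comps'] exI[of _ "nq1 + nq"] exI[of _ "(a + nt1) + nt"])
        (simp add: distrib_left)
  qed
qed

lemma search_result_length:
  assumes "search_result X comps"
  shows "length (concat (map fst comps)) \<le> nvars \<Phi>"
    and "set (concat (map fst comps)) \<subseteq> vset \<Phi> - assigned \<Phi> X"
proof -
  show sub: "set (concat (map fst comps)) \<subseteq> vset \<Phi> - assigned \<Phi> X"
    using search_resultD(1)[OF assms] component_subset by fastforce
  have "length (concat (map fst comps)) = card (set (concat (map fst comps)))"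
    using assms by (intro distinct_card[symmetric]) (simp add: search_result_def)
  also have "\<dots> \<le> card (vset \<Phi>)" using sub by (intro card_mono) auto
  also have "\<dots> = nvars \<Phi>" using distinct_card[OF distinct_vars] by (simp add: nvars_def)
  finally show "length (concat (map fst comps)) \<le> nvars \<Phi>" .
qed

lemma find_components_cost:
  assumes "S \<subseteq> vset \<Phi> - assigned \<Phi> X"
  shows "\<exists>comps nq nt. find_components a \<Phi> X S = return_spmf (comps, nq, nt) \<and>
    search_result X comps \<and> nq \<le> max_deg \<Phi> * nvars \<Phi> \<and>
    nt \<le> 4 * (a * width \<Phi> * max_deg \<Phi> * nvars \<Phi>)"
proof -
  let ?vs = "filter (\<lambda>v. v \<in> S) (vars \<Phi>)"
  have "set ?vs \<subseteq> vset \<Phi> - assigned \<Phi> X" "search_result X []"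
    using assms by (auto simp: search_result_def)
  from foldp_components[OF this, of a] obtain comps nq nt where r:
    "find_components a \<Phi> X S = return_spmf (comps, nq, nt)" "search_result X comps"
    "nq \<le> max_deg \<Phi> * length (concat (map fst comps))"
    "nt \<le> 3 * (a * width \<Phi> * max_deg \<Phi>) * length (concat (map fst comps)) + a * length ?vs"
    unfolding find_components_def by auto
  have len: "length (concat (map fst comps)) \<le> nvars \<Phi>" by (rule search_result_length[OF r(2)])
  have "nq \<le> max_deg \<Phi> * nvars \<Phi>"
    using r(3) mult_le_mono2[OF len, of "max_deg \<Phi>"] by linarith
  moreover have "nt \<le> 4 * (a * width \<Phi> * max_deg \<Phi> * nvars \<Phi>)"
  proof -
    have "a * length ?vs \<le> a * nvars \<Phi>"
      unfolding nvars_def by (intro mult_left_mono length_filter_le) simp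
    also have "\<dots> \<le> a * nvars \<Phi> * (width \<Phi> * max_deg \<Phi>)" using params_ge by simp
    finally have "a * length ?vs \<le> a * width \<Phi> * max_deg \<Phi> * nvars \<Phi>" by (simp add: ac_simps)
    moreover have "3 * (a * width \<Phi> * max_deg \<Phi>) * length (concat (map fst comps))
        \<le> 3 * (a * width \<Phi> * max_deg \<Phi>) * nvars \<Phi>"
      using len by (intro mult_left_mono) auto
    ultimately show ?thesis using r(4) by linarith
  qed
  ultimately show ?thesis using r by blast
qed

section \<open>The rejection loop on one component\<close>

lemma foldp_query_all:
  assumes "set cs \<subseteq> set (cons \<Phi>)"
  shows "foldp (\<lambda>c ok. query a \<Phi> Y c ;; (\<lambda>sat. ret (ok \<and> sat))) cs ok
    = return_spmf (ok \<and> (\<forall>c\<in>set cs. satisfied_by \<Phi> Y c), length cs, a * width \<Phi> * length cs)"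
  using assms
proof (induction cs arbitrary: ok)
  case Nil
  show ?case by (simp add: ret_def)
next
  case (Cons c cs)
  then show ?case
    by (simp add: query_eq seq_return_spmf ret_def conj_assoc)
qed

text \<open>A round queries all constraints and so costs the same whether it succeeds or fails; this
  is the shape of loop that \<open>wp_loop_le\<close> treats.\<close>

lemma sample_component_unfold:
  assumes "set cs \<subseteq> set (cons \<Phi>)"
  shows "sample_component a \<Phi> X us cs = bind_pmf (uniform_on \<Phi> (set us)) (\<lambda>y.
    if \<forall>c\<in>set cs. satisfied_by \<Phi> (overlay X (set us) y) c
    then return_spmf (y, length cs, a * max_dom \<Phi> * length us + a * width \<Phi> * length cs)
    else map_spmf (\<lambda>(z, nq', nt'). (z, length cs + nq',
      a * max_dom \<Phi> * length us + a * width \<Phi> * length cs + nt')) (sample_component a \<Phi> X us cs))"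
  (is "_ = bind_pmf _ ?g")
proof -
  have "sample_component a \<Phi> X us cs
      = map_spmf (\<lambda>(y, nq', nt'). (y, 0 + nq', a * max_dom \<Phi> * length us + nt'))
        (bind_pmf (uniform_on \<Phi> (set us)) (\<lambda>y.
          map_spmf (\<lambda>(z, nq', nt'). (z, length cs + nq', a * width \<Phi> * length cs + nt'))
          (if \<forall>c\<in>set cs. satisfied_by \<Phi> (overlay X (set us) y) c then ret y
           else sample_component a \<Phi> X us cs)))"
    by (subst sample_component.simps)
      (simp only: charge_def seq_return_spmf draw_seq foldp_query_all[OF assms] simp_thms)
  also have "\<dots> = bind_pmf (uniform_on \<Phi> (set us)) ?g"
    unfolding map_bind_pmf
    by (intro bind_pmf_cong refl)
      (simp add: ret_def spmf.map_comp o_def case_prod_unfold add.assoc)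
  finally show ?thesis .
qed

text \<open>Avoiding only the constraints of the component keeps the exponent local. Their scopes
  lie in \<open>U\<close> and the assigned variables, so the values on \<open>U\<close> together
  with \<open>X\<close> decide them, and projecting the completion to \<open>U\<close> yields the
  law that a round draws from.\<close>

lemma sat_overlay_prob_ge:
  assumes small: "\<And>c. c \<in> set (cons \<Phi>) \<Longrightarrow> viol_prob_given \<Phi> X c \<le> lx / 2"
    and v: "v \<in> vset \<Phi> - assigned \<Phi> X" and U: "U = component X v"
  shows "(1 - lx) ^ card (edges X U)
    \<le> measure_pmf.prob (uniform_on \<Phi> U) {y. \<forall>c\<in>edges X U. satisfied_by \<Phi> (overlay X U y) c}"
    (is "_ \<le> measure_pmf.prob _ ?G")
proof -
  interpret local_lemma "completion X" "set (cons \<Phi>)" violated share lx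
    by (rule local_lemma_completion[OF small])
  have Usub: "U \<subseteq> vset \<Phi> - assigned \<Phi> X" using component_subset[OF v] U by simp
  have "(1 - lx) ^ card (edges X U) \<le> measure_pmf.prob (completion X) (avoid violated (edges X U))"
    by (rule avoid_ge) (auto simp: edges_def)
  also have "\<dots> \<le> measure_pmf.prob (completion X) ?G"
  proof (rule measure_pmf.finite_measure_mono_AE)
    show "AE x in measure_pmf (completion X). x \<in> avoid violated (edges X U) \<longrightarrow> x \<in> ?G"
      unfolding AE_measure_pmf_iff
    proof (intro ballI impI, unfold mem_Collect_eq, intro ballI)
      fix x c
      assume "x \<in> set_pmf (completion X)" and good: "x \<in> avoid violated (edges X U)"
        and c: "c \<in> edges X U"
      then have x: "x \<in> PiE (vset \<Phi>) (dom_of X)" by (simp add: set_completion)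
      obtain u where u: "u \<in> vbl \<Phi> c" "u \<in> U" using c by (auto simp: edges_def)
      have cC: "c \<in> set (cons \<Phi>)" using c by (simp add: edges_def)
      have over: "overlay X U x w = Val (x w) \<and> w \<in> assigned \<Phi> (overlay X U x)"
        if w: "w \<in> vbl \<Phi> c" for w
      proof -
        have wV: "w \<in> vset \<Phi>" using w vbl_subset[OF cC] by auto
        have "overlay X U x w = Val (x w)"
        proof (cases "w \<in> U")
          case False
          \<comment> \<open>An unassigned \<open>w\<close> in the scope of \<open>c\<close> would be
            linked to \<open>u\<close> and hence lie in \<open>U\<close>.\<close>
          have "w \<in> assigned \<Phi> X"
          proof (rule ccontr)
            assume "w \<notin> assigned \<Phi> X"
            then have "linked X u w" using u w c Usub by (auto simp: linked_def edges_def)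
            then show False using component_step u(2) False U by blast
          qed
          then show ?thesis using x wV False by (auto simp: overlay_def dom_of_def PiE_iff)
        qed (simp add: overlay_def)
        then show ?thesis using x wV by (auto simp: assigned_def dom_of_def PiE_iff)
      qed
      show "satisfied_by \<Phi> (overlay X U x) c"
        unfolding satisfied_by_def
      proof
        fix z assume "z \<in> assignments \<Phi> \<inter> agrees \<Phi> (overlay X U x)"
        then have "\<forall>w\<in>vbl \<Phi> c. z w = x w" using over by (fastforce simp: agrees_def)
        then have "con_true \<Phi> c z = con_true \<Phi> c x" by (rule con_true_cong)
        then show "con_true \<Phi> c z" using good c by (auto simp: avoid_def violated_def)
      qed
    qed
  qed simp
  also have "\<dots> = measure_pmf.prob (Pi_pmf U undefined (\<lambda>v. pmf_of_set (dom_of X v))) ?G"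
    unfolding completion_def
  proof (rule prob_Pi_pmf_marginal)
    fix x y :: "'v \<Rightarrow> 'a" assume "\<forall>v\<in>U. x v = y v"
    then have "overlay X U x = overlay X U y" by (auto simp: overlay_def)
    then show "x \<in> ?G \<longleftrightarrow> y \<in> ?G" by simp
  qed (use Usub in auto)
  also have "Pi_pmf U undefined (\<lambda>v. pmf_of_set (dom_of X v)) = uniform_on \<Phi> U"
    unfolding uniform_on_def
    by (rule Pi_pmf_cong) (use Usub in \<open>auto simp: dom_of_unassigned\<close>)
  finally show ?thesis .
qed

lemma sample_component_cost:
  assumes small: "\<And>c. c \<in> set (cons \<Phi>) \<Longrightarrow> viol_prob_given \<Phi> X c \<le> lx / 2"
    and v: "v \<in> vset \<Phi> - assigned \<Phi> X"
    and us: "set us = component X v" and cs: "set cs = edges X (set us)" "distinct cs"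
  shows "wp \<alpha> \<beta> (sample_component a \<Phi> X us cs) (\<lambda>_. 0)
    \<le> ennreal (real (\<alpha> * length cs + \<beta> * (a * max_dom \<Phi> * length us + a * width \<Phi> * length cs))
        / (1 - lx) ^ length cs)"
proof (rule wp_loop_le)
  have "set cs \<subseteq> set (cons \<Phi>)" using cs by (auto simp: edges_def)
  then show "sample_component a \<Phi> X us cs = bind_pmf (uniform_on \<Phi> (set us)) (\<lambda>y.
    if \<forall>c\<in>set cs. satisfied_by \<Phi> (overlay X (set us) y) c
    then return_spmf (y, length cs, a * max_dom \<Phi> * length us + a * width \<Phi> * length cs)
    else map_spmf (\<lambda>(z, nq', nt'). (z, length cs + nq',
      a * max_dom \<Phi> * length us + a * width \<Phi> * length cs + nt')) (sample_component a \<Phi> X us cs))"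
    by (rule sample_component_unfold)
  have "length cs = card (edges X (set us))" using distinct_card[OF cs(2)] cs(1) by simp
  then show "(1 - lx) ^ length cs \<le> measure_pmf.prob (uniform_on \<Phi> (set us))
      {y. \<forall>c\<in>set cs. satisfied_by \<Phi> (overlay X (set us) y) c}"
    using sat_overlay_prob_ge[OF small v us] cs(1) by simp
  show "0 < (1 - lx) ^ length cs" using mult_lx_le(4) by (intro zero_less_power) linarith
qed

lemma rejection_sampling_cost:
  assumes small: "\<And>c. c \<in> set (cons \<Phi>) \<Longrightarrow> viol_prob_given \<Phi> X c \<le> lx / 2"
  shows "\<exists>comps. search_result X comps \<and>
    wp \<alpha> \<beta> (rejection_sampling a \<Phi> X (vset \<Phi> - assigned \<Phi> X)) (\<lambda>_. 0)
    \<le> of_nat (\<alpha> * (max_deg \<Phi> * nvars \<Phi>) + \<beta> * (5 * (a * width \<Phi> * max_deg \<Phi> * nvars \<Phi>)))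
      + (\<Sum>(us, cs)\<leftarrow>comps. ennreal (real (\<alpha> * length cs
          + \<beta> * (a * max_dom \<Phi> * length us + a * width \<Phi> * length cs)) / (1 - lx) ^ length cs))"
proof -
  let ?S = "vset \<Phi> - assigned \<Phi> X"
  let ?w = "\<lambda>(us, cs). ennreal (real (\<alpha> * length cs
          + \<beta> * (a * max_dom \<Phi> * length us + a * width \<Phi> * length cs)) / (1 - lx) ^ length cs)"
  let ?f = "\<lambda>(us, cs) x. sample_component a \<Phi> X us cs ;; (\<lambda>y. ret (\<lambda>v. if v \<in> set us then y v else x v))"
  obtain comps nq nt where r: "find_components a \<Phi> X ?S = return_spmf (comps, nq, nt)"
    "search_result X comps" "nq \<le> max_deg \<Phi> * nvars \<Phi>"
    "nt \<le> 4 * (a * width \<Phi> * max_deg \<Phi> * nvars \<Phi>)"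
    using find_components_cost[of ?S X] by blast
  have "wp \<alpha> \<beta> (foldp ?f comps (\<lambda>_. undefined)) (\<lambda>_. 0) \<le> sum_list (map ?w comps)"
  proof (rule wp_foldp_le)
    fix comp and x :: "'v \<Rightarrow> 'a"
    assume "comp \<in> set comps"
    then obtain us cs where mem: "comp = (us, cs)" "(us, cs) \<in> set comps" by (metis surj_pair)
    then obtain v where "v \<in> ?S" "set us = component X v"
      using search_resultD(1)[OF r(2)] by blast
    note comp = mem(1) this search_resultD(2,4)[OF r(2) mem(2)]
    show "wp \<alpha> \<beta> (?f comp x) (\<lambda>_. 0) \<le> ?w comp"
      using sample_component_cost[OF small comp(2-5)] by (simp add: comp(1))
  qed
  moreover have "card ?S \<le> nvars \<Phi>"
    using card_mono[of "vset \<Phi>" ?S] distinct_card[OF distinct_vars] by (simp add: nvars_def)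
  then have "a * card ?S * 1 \<le> a * nvars \<Phi> * (width \<Phi> * max_deg \<Phi>)"
    using params_ge by (intro mult_mono) auto
  then have "a * card ?S \<le> a * width \<Phi> * max_deg \<Phi> * nvars \<Phi>" by (simp add: ac_simps)
  \<comment> \<open>Four units come from the search; the fifth pays for writing the output on
    \<open>?S\<close>.\<close>
  then have "nt + a * card ?S \<le> 5 * (a * width \<Phi> * max_deg \<Phi> * nvars \<Phi>)" using r(4) by linarith
  then have "\<alpha> * nq + \<beta> * (nt + a * card ?S)
      \<le> \<alpha> * (max_deg \<Phi> * nvars \<Phi>) + \<beta> * (5 * (a * width \<Phi> * max_deg \<Phi> * nvars \<Phi>))"
    using r(3) by (intro add_mono mult_left_mono) auto
  moreover have "wp \<alpha> \<beta> (rejection_sampling a \<Phi> X ?S) (\<lambda>_. 0)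
      = of_nat (\<alpha> * nq + \<beta> * (nt + a * card ?S)) + wp \<alpha> \<beta> (foldp ?f comps (\<lambda>_. undefined)) (\<lambda>_. 0)"
  proof -
    have "wp \<alpha> \<beta> (rejection_sampling a \<Phi> X ?S) (\<lambda>_. 0) = of_nat (\<alpha> * nq + \<beta> * nt)
        + wp \<alpha> \<beta> (foldp ?f comps (\<lambda>_. undefined)) (\<lambda>_. of_nat (\<beta> * (a * card ?S)))"
      unfolding rejection_sampling_def r(1) by simp
    also have "wp \<alpha> \<beta> (foldp ?f comps (\<lambda>_. undefined)) (\<lambda>_. of_nat (\<beta> * (a * card ?S)))
        = wp \<alpha> \<beta> (foldp ?f comps (\<lambda>_. undefined)) (\<lambda>_. 0) + of_nat (\<beta> * (a * card ?S))"
      by (rule wp_add_const)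
    finally show ?thesis by (simp add: algebra_simps)
  qed
  ultimately show ?thesis
    using r(2) by (intro exI[of _ comps]) (auto intro!: add_mono simp: of_nat_le_iff simp del: of_nat_add of_nat_mult)
qed

end

section \<open>Clusters of frozen constraints\<close>

text \<open>The charging argument: each component charges one of its own vertices, and by
  disjointness no vertex is charged twice.\<close>

lemma sum_list_le_sum_disjoint:
  fixes Z :: "'v \<Rightarrow> ennreal"
  assumes "distinct (concat (map fst comps))"
    and "\<And>comp. comp \<in> set comps \<Longrightarrow> \<exists>v\<in>set (fst comp). h comp \<le> Z v"
  shows "sum_list (map h comps) \<le> (\<Sum>v\<in>set (concat (map fst comps)). Z v)"
  using assms
proof (induction comps)
  case Nil
  show ?case by simp
next
  case (Cons comp comps)
  obtain v where v: "v \<in> set (fst comp)" "h comp \<le> Z v" using Cons.prems(2)[of comp] by auto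
  have "Z v \<le> (\<Sum>v\<in>set (fst comp). Z v)"
    using v by (intro member_le_sum) auto
  then have "h comp \<le> (\<Sum>v\<in>set (fst comp). Z v)" using v by simp
  moreover have "sum_list (map h comps) \<le> (\<Sum>v\<in>set (concat (map fst comps)). Z v)"
    using Cons by simp
  moreover have "(\<Sum>v\<in>set (concat (map fst (comp # comps))). Z v)
      = (\<Sum>v\<in>set (fst comp). Z v) + (\<Sum>v\<in>set (concat (map fst comps)). Z v)"
    using Cons.prems(1) by (simp only: list.map concat.simps set_append distinct_append)
      (rule sum.union_disjoint; simp)
  ultimately show ?case by (simp only: list.map sum_list.Cons add_mono)
qed

context csp_formula
begin

lemma share_sym: "share c d \<Longrightarrow> share d c"
  by (auto simp: share_def)

lemma shareI: "u \<in> vbl \<Phi> c \<Longrightarrow> u \<in> vbl \<Phi> d \<Longrightarrow> share c d"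
  by (auto simp: share_def)

definition near :: "'c \<Rightarrow> 'c \<Rightarrow> bool" where
  "near c d \<longleftrightarrow> (\<exists>e\<in>set (cons \<Phi>). \<exists>f\<in>set (cons \<Phi>). share c e \<and> share e f \<and> share f d)"

lemma card_share_UN_le:
  assumes "T \<subseteq> set (cons \<Phi>)" "\<And>c. c \<in> set (cons \<Phi>) \<Longrightarrow> card (F c) \<le> m"
  shows "card (\<Union>c\<in>T. F c) \<le> m * card T"
proof -
  have "card (\<Union>c\<in>T. F c) \<le> (\<Sum>c\<in>T. card (F c))"
    using assms(1) finite_subset by (intro card_UN_le) auto
  also have "\<dots> \<le> m * card T"
    using sum_bounded_above[of T "\<lambda>c. card (F c)" m] assms by (auto simp: mult.commute)
  finally show ?thesis .
qed

lemma card_share2_le: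
  assumes c: "c \<in> set (cons \<Phi>)"
  shows "card (\<Union>e\<in>{e \<in> set (cons \<Phi>). share c e}. {f \<in> set (cons \<Phi>). share e f}) \<le> max_deg \<Phi> ^ 2"
proof -
  have "card (\<Union>e\<in>{e \<in> set (cons \<Phi>). share c e}. {f \<in> set (cons \<Phi>). share e f})
      \<le> max_deg \<Phi> * card {e \<in> set (cons \<Phi>). share c e}"
    by (rule card_share_UN_le) (auto intro: card_share_le)
  also have "\<dots> \<le> max_deg \<Phi> * max_deg \<Phi>"
    by (rule mult_le_mono2) (rule card_share_le[OF c])
  finally show ?thesis by (simp add: power2_eq_square)
qed

lemma card_near_le:
  assumes c: "c \<in> set (cons \<Phi>)"
  shows "card {d \<in> set (cons \<Phi>). near c d} \<le> max_deg \<Phi> ^ 3"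
proof -
  let ?U = "\<Union>e\<in>{e \<in> set (cons \<Phi>). share c e}. {f \<in> set (cons \<Phi>). share e f}"
  have "card {d \<in> set (cons \<Phi>). near c d} \<le> card (\<Union>f\<in>?U. {d \<in> set (cons \<Phi>). share f d})"
    by (intro card_mono) (auto simp: near_def)
  also have "\<dots> \<le> max_deg \<Phi> * card ?U"
    by (rule card_share_UN_le) (auto intro: card_share_le)
  also have "\<dots> \<le> max_deg \<Phi> * max_deg \<Phi> ^ 2"
    by (rule mult_le_mono2) (rule card_share2_le[OF c])
  finally show ?thesis by (simp add: power3_eq_cube power2_eq_square)
qed

end

section \<open>Covering components by clusters, and the charging scheme\<close>

context frozen_process
begin

definition clusters :: "'c \<Rightarrow> 'c set set" where
  "clusters f = {T. packed T \<and> grown_from near {f} T}"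

lemma finite_clusters: "finite (clusters f)"
  by (rule finite_subset[of _ "Pow (set (cons \<Phi>))"]) (auto simp: clusters_def packed_def)

lemma clusters_weight_le:
  assumes f: "f \<in> set (cons \<Phi>)"
  shows "(\<Sum>T\<in>clusters f. (1 / (4 * real (max_deg \<Phi>) ^ 3)) ^ card T) \<le> 1 / (2 * real (max_deg \<Phi>) ^ 3)"
proof -
  have "(\<Sum>T\<in>clusters f. (1 / (4 * real (max_deg \<Phi>) ^ 3)) ^ card T)
      \<le> (\<Sum>T | T \<subseteq> set (cons \<Phi>) \<and> grown_from near {f} T. (1 / (4 * real (max_deg \<Phi> ^ 3))) ^ card T)"
    unfolding of_nat_power by (intro sum_mono2) (auto simp: clusters_def packed_def)
  also have "\<dots> \<le> 1 / (2 * real (max_deg \<Phi> ^ 3))"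
    using params_ge by (intro grown_weight_le f card_near_le) auto
  finally show ?thesis by simp
qed

lemma unassigned_in_frozen:
  assumes R: "reached (nvars \<Phi>) X" and w: "w \<in> vset \<Phi> - assigned \<Phi> X"
  shows "\<exists>c\<in>set (cons \<Phi>). w \<in> vbl \<Phi> c \<and> D c X"
proof -
  obtain j where "j < nvars \<Phi>" "w = vars \<Phi> ! j"
    using w by (auto simp: in_set_conv_nth nvars_def)
  then show ?thesis using R w by (auto simp: reached_def)
qed

lemma frozen_not_satisfied:
  assumes "reached (nvars \<Phi>) X" "c \<in> set (cons \<Phi>)" "D c X"
  shows "\<not> satisfied_by \<Phi> X c"
  using frozen_viol_prob_ge[of c X] assms p_thr_pos
  by (auto simp: satisfied_by_iff reached_def admissible_def)

text \<open>Every unassigned variable lies in a frozen constraint, so a variable next to one covered by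
  frozen neighbours of \<open>T\<close> lies in a frozen constraint \<open>near\<close> \<open>T\<close>. If \<open>T\<close> is maximal, this
  constraint meets \<open>T\<close> again; hence frozen neighbours of \<open>T\<close> cover the whole component.\<close>

lemma component_cluster:
  assumes R: "reached (nvars \<Phi>) X" and v: "v \<in> vset \<Phi> - assigned \<Phi> X"
  shows "\<exists>f\<in>set (cons \<Phi>). v \<in> vbl \<Phi> f \<and> (\<exists>T\<in>clusters f. (\<forall>c\<in>T. D c X) \<and>
    card (edges X (component X v)) \<le> max_deg \<Phi> ^ 2 * card T)"
proof -
  obtain f where f: "f \<in> set (cons \<Phi>)" "v \<in> vbl \<Phi> f" "D f X"
    using unassigned_in_frozen[OF R v] by blast
  let ?F = "{T \<in> clusters f. \<forall>c\<in>T. D c X}"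
  have "{f} \<in> ?F" using f by (auto simp: clusters_def packed_def grown_from_refl)
  then have "?F \<noteq> {}" by (rule ex_in_conv[THEN iffD1, OF exI])
  moreover have "finite ?F" using finite_clusters[of f] by simp
  ultimately obtain T where T: "T \<in> ?F" and "\<forall>T'\<in>?F. T \<subseteq> T' \<longrightarrow> T = T'"
    using finite_has_maximal[of ?F] by (elim meta_impE bexE)
  then have max: "\<And>T'. T' \<in> ?F \<Longrightarrow> T \<subseteq> T' \<Longrightarrow> T = T'" by blast
  have pT: "packed T" and gT: "grown_from near {f} T" and DT: "\<forall>c\<in>T. D c X"
    using T by (auto simp: clusters_def)
  have TC: "T \<subseteq> set (cons \<Phi>)" using pT by (simp add: packed_def)
  have fT: "f \<in> T" using gT by (simp add: grown_from_def)
  define A where "A = {u. \<exists>g\<in>set (cons \<Phi>). u \<in> vbl \<Phi> g \<and> (\<exists>t\<in>T. share t g)}"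
  have sub: "component X v \<subseteq> A"
  proof (rule component_subset_closed)
    show "v \<in> A" using f fT shareI[OF f(2) f(2)] by (auto simp: A_def)
    fix u w assume "u \<in> A" and uw: "linked X u w"
    then obtain g t where g: "g \<in> set (cons \<Phi>)" "u \<in> vbl \<Phi> g" "t \<in> T" "share t g"
      by (auto simp: A_def)
    obtain c where c: "c \<in> set (cons \<Phi>)" "u \<in> vbl \<Phi> c" "w \<in> vbl \<Phi> c" "w \<notin> assigned \<Phi> X"
      using uw by (auto simp: linked_def)
    have "w \<in> vset \<Phi> - assigned \<Phi> X" using c vbl_subset by auto
    then obtain h where h: "h \<in> set (cons \<Phi>)" "w \<in> vbl \<Phi> h" "D h X"
      using unassigned_in_frozen[OF R] by blast
    have "\<exists>t\<in>T. share t h"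
    proof (rule ccontr)
      assume none: "\<not> (\<exists>t\<in>T. share t h)"
      \<comment> \<open>Here \<open>t\<close> meets \<open>g\<close>, \<open>g\<close> meets
        \<open>c\<close> in \<open>u\<close>, and \<open>c\<close> meets \<open>h\<close> in
        \<open>w\<close>; this accounts for the three steps in \<open>near\<close>.\<close>
      have "near t h"
        unfolding near_def using g c h shareI[OF g(2) c(2)] shareI[OF c(3) h(2)] by blast
      then have "grown_from near {f} (insert h T)"
        by (rule grown_from_insert_right[OF gT g(3)])
      moreover have "packed (insert h T)"
        using pT h none share_sym by (auto simp: packed_def)
      ultimately have "insert h T \<in> ?F" using DT h by (simp add: clusters_def)
      then have "h \<in> T" using max[of "insert h T"] by blast
      then show False using none shareI[OF h(2) h(2)] by blast
    qed
    then show "w \<in> A" using h by (auto simp: A_def)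
  qed
  \<comment> \<open>A constraint meeting \<open>A\<close> is two \<open>share\<close> steps away
    from \<open>T\<close>, which gives the factor \<Delta>^2 per element of
    \<open>T\<close>.\<close>
  have "edges X (component X v) \<subseteq> (\<Union>t\<in>T. \<Union>e\<in>{e \<in> set (cons \<Phi>). share t e}. {c \<in> set (cons \<Phi>). share e c})"
  proof
    fix c assume "c \<in> edges X (component X v)"
    then obtain u where u: "c \<in> set (cons \<Phi>)" "u \<in> vbl \<Phi> c" "u \<in> A"
      using sub by (auto simp: edges_def)
    then obtain g t where g: "g \<in> set (cons \<Phi>)" "u \<in> vbl \<Phi> g" "t \<in> T" "share t g"
      by (auto simp: A_def)
    have "share g c" by (rule shareI[OF g(2) u(2)])
    then show "c \<in> (\<Union>t\<in>T. \<Union>e\<in>{e \<in> set (cons \<Phi>). share t e}. {c \<in> set (cons \<Phi>). share e c})"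
      using u(1) g(1,3,4) by auto
  qed
  then have "card (edges X (component X v))
      \<le> card (\<Union>t\<in>T. \<Union>e\<in>{e \<in> set (cons \<Phi>). share t e}. {c \<in> set (cons \<Phi>). share e c})"
    using TC finite_subset[OF TC] by (intro card_mono) auto
  also have "\<dots> \<le> max_deg \<Phi> ^ 2 * card T"
    by (rule card_share_UN_le[OF TC card_share2_le])
  finally show ?thesis using f DT pT gT by (auto simp: clusters_def)
qed

text \<open>There are no isolated vertices: an unassigned variable lies in a frozen constraint,
  whose violation probability is positive, so that constraint is an edge. This lets the number of
  edges also pay for drawing the vertices.\<close>

lemma component_length_le:
  assumes R: "reached (nvars \<Phi>) X" and v: "v \<in> vset \<Phi> - assigned \<Phi> X"
  shows "card (component X v) \<le> width \<Phi> * card (edges X (component X v))"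
proof -
  have "component X v \<subseteq> (\<Union>c\<in>edges X (component X v). vbl \<Phi> c)"
  proof
    fix w assume w: "w \<in> component X v"
    then have "w \<in> vset \<Phi> - assigned \<Phi> X" using component_subset[OF v] by auto
    then obtain c where c: "c \<in> set (cons \<Phi>)" "w \<in> vbl \<Phi> c" "D c X"
      using unassigned_in_frozen[OF R] by blast
    then show "w \<in> (\<Union>c\<in>edges X (component X v). vbl \<Phi> c)"
      using frozen_not_satisfied[OF R c(1,3)] w by (auto simp: edges_def)
  qed
  then have "card (component X v) \<le> card (\<Union>c\<in>edges X (component X v). vbl \<Phi> c)"
    using finite_vbl by (intro card_mono) (auto simp: edges_def)
  also have "\<dots> \<le> width \<Phi> * card (edges X (component X v))"
    by (rule card_share_UN_le[OF _ card_vbl_le]) (auto simp: edges_def)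
  finally show ?thesis .
qed

text \<open>Which cluster covers the component of \<open>v\<close> depends on \<open>X\<close>.
  Summing over all possible roots \<open>f\<close> and clusters \<open>T\<close>, each with an
  indicator, gives an upper bound whose expectation can be taken term by term.\<close>

definition charged :: "('v \<Rightarrow> 'a pval) \<Rightarrow> 'v \<Rightarrow> ennreal" where
  "charged X v = (\<Sum>f | f \<in> set (cons \<Phi>) \<and> v \<in> vbl \<Phi> f. \<Sum>T\<in>clusters f.
     ennreal (real (max_deg \<Phi>) ^ 2 * 4 ^ card T) * of_bool (\<forall>c\<in>T. D c X))"

text \<open>Since (1 - x)^(\<Delta>^2) \<ge> 1/2, the bound N \<le> \<Delta>^2 |T| limits the
  expected rounds to 2^|T|. The remaining factor N is at most \<Delta>^2 2^|T|, and together they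
  give 4^|T|.\<close>

lemma rounds_le_charged:
  assumes R: "reached (nvars \<Phi>) X" and v: "v \<in> vset \<Phi> - assigned \<Phi> X"
    and N: "N = card (edges X (component X v))"
  shows "ennreal (real N / (1 - lx) ^ N) \<le> charged X v"
proof -
  obtain f T where f: "f \<in> set (cons \<Phi>)" "v \<in> vbl \<Phi> f" and T: "T \<in> clusters f" "\<forall>c\<in>T. D c X"
    and le: "N \<le> max_deg \<Phi> ^ 2 * card T"
    using component_cluster[OF R v] N by blast
  have lx: "0 \<le> lx" "lx \<le> 1/18" using lx_pos mult_lx_le(4) by auto
  have "1 - real (max_deg \<Phi> ^ 2) * lx \<le> (1 - lx) ^ (max_deg \<Phi> ^ 2)"
    using Bernoulli_inequality[of "- lx" "max_deg \<Phi> ^ 2"] lx by simp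
  then have "1/2 \<le> (1 - lx) ^ (max_deg \<Phi> ^ 2)" using mult_lx_le(2) by simp
  then have "(1/2) ^ card T \<le> ((1 - lx) ^ (max_deg \<Phi> ^ 2)) ^ card T" by (intro power_mono) auto
  also have "\<dots> \<le> (1 - lx) ^ N"
    unfolding power_mult[symmetric] using lx le by (intro power_decreasing) auto
  finally have pow: "(1/2) ^ card T \<le> (1 - lx) ^ N" .
  have t: "real (card T) \<le> 2 ^ card T"
    using of_nat_less_two_power[of "card T", where ?'a = real] by simp
  have "real N / (1 - lx) ^ N \<le> real N / (1/2) ^ card T"
    using pow lx by (intro divide_left_mono mult_pos_pos) auto
  also have "\<dots> = real N * 2 ^ card T" by (simp add: power_divide)
  also have "\<dots> \<le> (real (max_deg \<Phi>) ^ 2 * 2 ^ card T) * 2 ^ card T"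
  proof (rule mult_right_mono)
    have "real N \<le> real (max_deg \<Phi>) ^ 2 * real (card T)"
      using of_nat_mono[OF le, where ?'a = real] by simp
    also have "\<dots> \<le> real (max_deg \<Phi>) ^ 2 * 2 ^ card T"
      using t by (intro mult_left_mono) auto
    finally show "real N \<le> real (max_deg \<Phi>) ^ 2 * 2 ^ card T" .
  qed simp
  also have "\<dots> = real (max_deg \<Phi>) ^ 2 * 4 ^ card T"
    by (simp add: power_mult_distrib[symmetric] mult.assoc)
  finally have "ennreal (real N / (1 - lx) ^ N)
      \<le> ennreal (real (max_deg \<Phi>) ^ 2 * 4 ^ card T) * of_bool (\<forall>c\<in>T. D c X)"
    using T(2) by (simp add: ennreal_leI)
  also have "\<dots> \<le> (\<Sum>T\<in>clusters f. ennreal (real (max_deg \<Phi>) ^ 2 * 4 ^ card T) * of_bool (\<forall>c\<in>T. D c X))"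
    using T(1) finite_clusters by (intro member_le_sum) auto
  also have "\<dots> \<le> charged X v"
    unfolding charged_def
    by (rule member_le_sum[where f = "\<lambda>f. \<Sum>T\<in>clusters f. ennreal (real (max_deg \<Phi>) ^ 2 * 4 ^ card T) * of_bool (\<forall>c\<in>T. D c X)"])
      (use f in auto)
  finally show ?thesis .
qed

text \<open>The cost 4 per constraint turns the probability 1 / (16 \<Delta>^3) into 1 / (4
  \<Delta>^3), exactly the weight summed in \<open>clusters_weight_le\<close>. A root then
  contributes at most \<Delta>^2 / (2 \<Delta>^3) \<le> 1 / \<Delta>, and at most \<Delta>
  constraints contain \<open>v\<close>.\<close>

lemma charged_expectation_le:
  "(\<integral>\<^sup>+ X. charged X v \<partial>measure_pmf (process \<Phi> D (nvars \<Phi>))) \<le> 1"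
proof -
  let ?P = "measure_pmf (process \<Phi> D (nvars \<Phi>))"
  let ?d = "real (max_deg \<Phi>)"
  let ?N = "{f. f \<in> set (cons \<Phi>) \<and> v \<in> vbl \<Phi> f}"
  have d: "1 \<le> ?d" using params_ge by simp
  have inner: "(\<Sum>T\<in>clusters f. \<integral>\<^sup>+ X. ennreal (?d ^ 2 * 4 ^ card T) * of_bool (\<forall>c\<in>T. D c X) \<partial>?P)
      \<le> ennreal (1 / ?d)" if f: "f \<in> ?N" for f
  proof -
    have "(\<integral>\<^sup>+ X. ennreal (?d ^ 2 * 4 ^ card T) * of_bool (\<forall>c\<in>T. D c X) \<partial>?P)
        \<le> ennreal (?d ^ 2 * (1 / (4 * ?d ^ 3)) ^ card T)" if T: "T \<in> clusters f" for T
    proof -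
      have "(\<integral>\<^sup>+ X. ennreal (?d ^ 2 * 4 ^ card T) * of_bool (\<forall>c\<in>T. D c X) \<partial>?P)
          = ennreal (?d ^ 2 * 4 ^ card T) * (\<integral>\<^sup>+ X. of_bool (\<forall>c\<in>T. D c X) \<partial>?P)"
        by (rule nn_integral_cmult) simp
      also have "\<dots> \<le> ennreal (?d ^ 2 * 4 ^ card T) * ennreal ((1 / (16 * ?d ^ 3)) ^ card T)"
        using T by (intro mult_left_mono all_frozen_prob_le) (auto simp: clusters_def)
      also have "\<dots> = ennreal (?d ^ 2 * 4 ^ card T * (1 / (16 * ?d ^ 3)) ^ card T)"
        by (rule ennreal_mult[symmetric]) auto
      also have "?d ^ 2 * 4 ^ card T * (1 / (16 * ?d ^ 3)) ^ card T = ?d ^ 2 * (4 * (1 / (16 * ?d ^ 3))) ^ card T"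
        by (simp only: power_mult_distrib mult.assoc)
      also have "4 * (1 / (16 * ?d ^ 3)) = 1 / (4 * ?d ^ 3)" by simp
      finally show ?thesis .
    qed
    then have "(\<Sum>T\<in>clusters f. \<integral>\<^sup>+ X. ennreal (?d ^ 2 * 4 ^ card T) * of_bool (\<forall>c\<in>T. D c X) \<partial>?P)
        \<le> (\<Sum>T\<in>clusters f. ennreal (?d ^ 2 * (1 / (4 * ?d ^ 3)) ^ card T))"
      by (rule sum_mono)
    also have "\<dots> = ennreal (?d ^ 2 * (\<Sum>T\<in>clusters f. (1 / (4 * ?d ^ 3)) ^ card T))"
      by (subst sum_ennreal) (auto simp: sum_distrib_left)
    also have "\<dots> \<le> ennreal (?d ^ 2 * (1 / (2 * ?d ^ 3)))"
      using f by (intro ennreal_leI mult_left_mono clusters_weight_le) auto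
    also have "\<dots> \<le> ennreal (1 / ?d)"
      using d by (intro ennreal_leI) (simp add: field_simps power2_eq_square power3_eq_cube)
    finally show ?thesis .
  qed
  have "(\<integral>\<^sup>+ X. charged X v \<partial>?P) = (\<Sum>f\<in>?N. \<Sum>T\<in>clusters f.
      \<integral>\<^sup>+ X. ennreal (?d ^ 2 * 4 ^ card T) * of_bool (\<forall>c\<in>T. D c X) \<partial>?P)"
    unfolding charged_def by (simp add: nn_integral_sum)
  also have "\<dots> \<le> (\<Sum>f\<in>?N. ennreal (1 / ?d))"
    by (rule sum_mono) (rule inner)
  also have "\<dots> = ennreal (real (card ?N) * (1 / ?d))"
    by (subst sum_ennreal) auto
  also have "\<dots> \<le> ennreal 1"
    using card_containing_le[of v] d by (intro ennreal_leI) (simp add: field_simps)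
  finally show ?thesis by simp
qed

text \<open>In one round, drawing costs at most a q k N by \<open>component_length_le\<close>, and
  the queries cost a k N, which is no more; hence the factor 2.\<close>

lemma component_cost_le:
  assumes R: "reached (nvars \<Phi>) X" and v: "v \<in> vset \<Phi> - assigned \<Phi> X"
    and us: "set us = component X v" "distinct us"
    and cs: "set cs = edges X (set us)" "distinct cs"
  shows "ennreal (real (\<alpha> * length cs
      + \<beta> * (a * max_dom \<Phi> * length us + a * width \<Phi> * length cs)) / (1 - lx) ^ length cs)
    \<le> of_nat (\<alpha> + \<beta> * (2 * (a * max_dom \<Phi> * width \<Phi>))) * charged X v"
proof -
  define N where "N = length cs"
  define K where "K = \<alpha> + \<beta> * (2 * (a * max_dom \<Phi> * width \<Phi>))"
  have N: "N = card (edges X (component X v))"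
    using distinct_card[OF cs(2)] cs(1) us(1) by (simp add: N_def)
  have pos: "0 < (1 - lx) ^ N" using mult_lx_le(4) by (intro zero_less_power) linarith
  have "length us \<le> width \<Phi> * N"
    using component_length_le[OF R v] distinct_card[OF us(2)] us(1) N by simp
  then have "a * max_dom \<Phi> * length us \<le> a * max_dom \<Phi> * (width \<Phi> * N)"
    by (rule mult_le_mono2)
  moreover have "a * width \<Phi> * N * 1 \<le> a * width \<Phi> * N * max_dom \<Phi>"
    using params_ge by (intro mult_le_mono2) auto
  then have "a * width \<Phi> * N \<le> a * max_dom \<Phi> * (width \<Phi> * N)" by (simp only: ac_simps mult_1_right)
  ultimately have "a * max_dom \<Phi> * length us + a * width \<Phi> * N \<le> 2 * (a * max_dom \<Phi> * width \<Phi>) * N"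
    by (simp only: mult.assoc)
  then have "\<beta> * (a * max_dom \<Phi> * length us + a * width \<Phi> * N)
      \<le> \<beta> * (2 * (a * max_dom \<Phi> * width \<Phi>) * N)"
    by (rule mult_le_mono2)
  then have "\<alpha> * N + \<beta> * (a * max_dom \<Phi> * length us + a * width \<Phi> * N) \<le> K * N"
    unfolding K_def distrib_right by (simp only: mult.assoc)
  then have "real (\<alpha> * N + \<beta> * (a * max_dom \<Phi> * length us + a * width \<Phi> * N)) / (1 - lx) ^ N
      \<le> real (K * N) / (1 - lx) ^ N"
    using pos by (intro divide_right_mono of_nat_mono) auto
  then have "ennreal (real (\<alpha> * N + \<beta> * (a * max_dom \<Phi> * length us + a * width \<Phi> * N)) / (1 - lx) ^ N)
      \<le> ennreal (real K * (real N / (1 - lx) ^ N))"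
    by (intro ennreal_leI) simp
  also have "\<dots> = of_nat K * ennreal (real N / (1 - lx) ^ N)"
    unfolding ennreal_of_nat_eq_real_of_nat using pos by (intro ennreal_mult) auto
  also have "\<dots> \<le> of_nat K * charged X v"
    by (intro mult_left_mono rounds_le_charged R v N) simp
  finally show ?thesis by (simp only: N_def K_def)
qed

section \<open>Expected total costs\<close>

lemma rejection_after_process_cost:
  "wp \<alpha> \<beta> (rejection_after_process a \<Phi> D) (\<lambda>_. 0)
    \<le> of_nat (\<alpha> * (max_deg \<Phi> * nvars \<Phi>) + \<beta> * (5 * (a * width \<Phi> * max_deg \<Phi> * nvars \<Phi>))
      + (\<alpha> + \<beta> * (2 * (a * max_dom \<Phi> * width \<Phi>))) * nvars \<Phi>)"
proof -
  let ?P = "measure_pmf (process \<Phi> D (nvars \<Phi>))"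
  define B where "B = \<alpha> * (max_deg \<Phi> * nvars \<Phi>) + \<beta> * (5 * (a * width \<Phi> * max_deg \<Phi> * nvars \<Phi>))"
  define K where "K = \<alpha> + \<beta> * (2 * (a * max_dom \<Phi> * width \<Phi>))"
  have "wp \<alpha> \<beta> (rejection_sampling a \<Phi> X (vset \<Phi> - assigned \<Phi> X)) (\<lambda>_. 0)
      \<le> of_nat B + of_nat K * (\<Sum>v\<in>vset \<Phi>. charged X v)"
    if "X \<in> set_pmf (process \<Phi> D (nvars \<Phi>))" for X
  proof -
    have R: "reached (nvars \<Phi>) X" using reached_process that by simp
    let ?h = "\<lambda>(us, cs). ennreal (real (\<alpha> * length cs
          + \<beta> * (a * max_dom \<Phi> * length us + a * width \<Phi> * length cs)) / (1 - lx) ^ length cs)"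
    have "\<And>c. c \<in> set (cons \<Phi>) \<Longrightarrow> viol_prob_given \<Phi> X c \<le> lx / 2"
      using R by (simp add: reached_def admissible_def)
    from rejection_sampling_cost[OF this, of \<alpha> \<beta> a] obtain comps where comps: "search_result X comps"
      "wp \<alpha> \<beta> (rejection_sampling a \<Phi> X (vset \<Phi> - assigned \<Phi> X)) (\<lambda>_. 0)
        \<le> of_nat B + sum_list (map ?h comps)"
      unfolding B_def by blast
    have "sum_list (map ?h comps) \<le> (\<Sum>v\<in>set (concat (map fst comps)). of_nat K * charged X v)"
    proof (rule sum_list_le_sum_disjoint)
      show "distinct (concat (map fst comps))" using comps by (simp add: search_result_def)
      fix comp assume "comp \<in> set comps"
      then obtain us cs where mem: "comp = (us, cs)" "(us, cs) \<in> set comps" by (metis surj_pair)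
      note res = search_resultD[OF comps(1) mem(2)]
      then obtain v where v: "v \<in> vset \<Phi> - assigned \<Phi> X" "set us = component X v" by blast
      have "?h comp \<le> of_nat K * charged X v"
        using component_cost_le[OF R v res(3,2,4)] by (simp add: mem(1) K_def)
      then show "\<exists>v\<in>set (fst comp). ?h comp \<le> of_nat K * charged X v"
        using v(2) component_refl[of v X] by (intro bexI[of _ v]) (simp_all add: mem(1))
    qed
    also have "\<dots> \<le> (\<Sum>v\<in>vset \<Phi>. of_nat K * charged X v)"
      using search_result_length(2)[OF comps(1)] by (intro sum_mono2) auto
    also have "\<dots> = of_nat K * (\<Sum>v\<in>vset \<Phi>. charged X v)" by (simp add: sum_distrib_left)
    finally show ?thesis using comps(2) by (meson add_left_mono order_trans)
  qed
  then have "wp \<alpha> \<beta> (rejection_after_process a \<Phi> D) (\<lambda>_. 0)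
      \<le> (\<integral>\<^sup>+ X. of_nat B + of_nat K * (\<Sum>v\<in>vset \<Phi>. charged X v) \<partial>?P)"
    unfolding rejection_after_process_def wp_bind_pmf
    by (intro nn_integral_mono_AE) (simp add: AE_measure_pmf_iff)
  also have "\<dots> = of_nat B + of_nat K * (\<Sum>v\<in>vset \<Phi>. \<integral>\<^sup>+ X. charged X v \<partial>?P)"
    by (simp add: nn_integral_add nn_integral_cmult nn_integral_sum)
  also have "\<dots> \<le> of_nat B + of_nat K * (\<Sum>v\<in>vset \<Phi>. 1)"
    by (intro add_left_mono mult_left_mono sum_mono charged_expectation_le) simp
  also have "(\<Sum>v\<in>vset \<Phi>. 1) = (of_nat (nvars \<Phi>) :: ennreal)"
    using distinct_card[OF distinct_vars] by (simp add: nvars_def)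
  finally show ?thesis by (simp add: B_def K_def)
qed

text \<open>The count obtained is (\<Delta> + 1) n: the search makes at most \<Delta> queries per
  vertex, and the rounds make at most one per variable in expectation.\<close>

lemma expected_queries_le:
  "expected_queries (rejection_after_process a \<Phi> D)
    \<le> ennreal (10 * real (max_deg \<Phi>) ^ 5 * real (nvars \<Phi>))"
proof -
  let ?d = "max_deg \<Phi>"
  have "?d ^ 1 \<le> ?d ^ 5" "1 \<le> ?d ^ 5" using params_ge by (intro power_increasing one_le_power; simp)+
  then have "?d + 1 \<le> 10 * ?d ^ 5" by simp
  then have "(?d + 1) * nvars \<Phi> \<le> 10 * ?d ^ 5 * nvars \<Phi>" by (rule mult_le_mono1)
  then have "of_nat (?d * nvars \<Phi> + nvars \<Phi>) \<le> (of_nat (10 * ?d ^ 5 * nvars \<Phi>) :: ennreal)"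
    by (subst of_nat_le_iff) (simp add: distrib_right)
  moreover have "expected_queries (rejection_after_process a \<Phi> D) \<le> of_nat (?d * nvars \<Phi> + nvars \<Phi>)"
    unfolding expected_queries_wp using rejection_after_process_cost[of 1 0 a] by simp
  ultimately have "expected_queries (rejection_after_process a \<Phi> D) \<le> of_nat (10 * ?d ^ 5 * nvars \<Phi>)"
    by (rule order_trans[rotated])
  then show ?thesis by (simp add: ennreal_of_nat_eq_real_of_nat)
qed

text \<open>Search and output give 5 a k \<Delta> n and the rounds 2 a q k n; both fit under
  multiples of a q k \<Delta>^5 n, whence the constant 7.\<close>

lemma expected_time_le:
  "expected_time (rejection_after_process a \<Phi> D)
    \<le> ennreal (7 * real a * real (max_dom \<Phi>) * real (width \<Phi>) * real (max_deg \<Phi>) ^ 5 * real (nvars \<Phi>))"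
proof -
  let ?d = "max_deg \<Phi>"
  let ?q = "max_dom \<Phi>"
  let ?b = "a * width \<Phi> * nvars \<Phi>"
  have d: "?d ^ 1 \<le> ?d ^ 5" "1 \<le> ?d ^ 5" using params_ge by (intro power_increasing one_le_power; simp)+
  have "1 * ?d \<le> ?q * ?d ^ 5" using params_ge d by (intro mult_mono) auto
  moreover have "?q * 1 \<le> ?q * ?d ^ 5" using d by (intro mult_le_mono2)
  ultimately have "5 * ?d + 2 * ?q \<le> 7 * (?q * ?d ^ 5)" by linarith
  then have "?b * (5 * ?d + 2 * ?q) \<le> ?b * (7 * (?q * ?d ^ 5))" by (rule mult_le_mono2)
  then have le: "5 * (a * width \<Phi> * ?d * nvars \<Phi>) + 2 * (a * ?q * width \<Phi>) * nvars \<Phi>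
      \<le> 7 * a * ?q * width \<Phi> * ?d ^ 5 * nvars \<Phi>"
    by (simp add: algebra_simps)
  have "expected_time (rejection_after_process a \<Phi> D)
      \<le> of_nat (5 * (a * width \<Phi> * ?d * nvars \<Phi>) + 2 * (a * ?q * width \<Phi>) * nvars \<Phi>)"
    unfolding expected_time_wp using rejection_after_process_cost[of 0 1 a] by simp
  also have "\<dots> \<le> of_nat (7 * a * ?q * width \<Phi> * ?d ^ 5 * nvars \<Phi>)"
    by (subst of_nat_le_iff) (rule le)
  finally show ?thesis by (simp add: ennreal_of_nat_eq_real_of_nat)
qed

end

theorem theorem6p34:
  fixes a :: nat
  shows "\<exists>C::real. \<forall>(\<Phi> :: ('v, 'a, 'c) csp) D.
    wf_csp \<Phi> \<longrightarrow> frozen_oracle \<Phi> D \<longrightarrow>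
    8 * exp 1 * viol_prob \<Phi> * real (max_deg \<Phi>) ^ 3 \<le> 0.99 * p_thr \<Phi> \<longrightarrow>
      expected_queries (rejection_after_process a \<Phi> D)
        \<le> ennreal (10 * real (max_deg \<Phi>) ^ 5 * real (nvars \<Phi>)) \<and>
      expected_time (rejection_after_process a \<Phi> D)
        \<le> ennreal (C * real (max_dom \<Phi>) * real (width \<Phi>) * real (max_deg \<Phi>) ^ 5 * real (nvars \<Phi>))"
proof (intro exI[of _ "7 * real a"] allI impI)
  fix \<Phi> :: "('v, 'a, 'c) csp" and D
  assume "wf_csp \<Phi>" "frozen_oracle \<Phi> D"
    "8 * exp 1 * viol_prob \<Phi> * real (max_deg \<Phi>) ^ 3 \<le> 0.99 * p_thr \<Phi>"
  then interpret frozen_process \<Phi> D by unfold_locales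
  show "expected_queries (rejection_after_process a \<Phi> D)
        \<le> ennreal (10 * real (max_deg \<Phi>) ^ 5 * real (nvars \<Phi>)) \<and>
      expected_time (rejection_after_process a \<Phi> D)
        \<le> ennreal (7 * real a * real (max_dom \<Phi>) * real (width \<Phi>) * real (max_deg \<Phi>) ^ 5 * real (nvars \<Phi>))"
    using expected_queries_le expected_time_le by simp
qed

end
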